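(* Let $r > 1$ be an integer, let $\delta>0$ be real, and let $u_1, \dots, u_m \in \mathbb{C}^d$ be vectors such that $$\sum_{i=1}^m u_i u_i^{*} = I_d \quad\text{and}\quad \|u_i\|^2 \le \delta \ \text{ for all } i\in\{1,\dots,m\}.$$ Then there exists a partition $\{A_1,\dots,A_r\}$ of $\{1,\dots,m\}$ (pairwise disjoint, possibly empty sets with union $\{1,\dots,m\}$) such that for every $j\in\{1,\dots,r\}$ $$\left\| \sum_{i \in A_j} u_i u_i^{*}\right\| \le \frac{1}{r}\left(1+\sqrt{r\delta}\right)^{2}.$$
   Context: Here $u^*$ is the conjugate transpose of the column vector $u$, $I_d$ is the $d\times d$ identity matrix, $\|u\|$ is the Euclidean norm for vectors, and $\|M\|$ is the operator (spectral) norm for matrices. *)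

theory Defs
  imports "HOL-Analysis.Analysis"
begin

definition outer_self :: "complex ^ 'd \<Rightarrow> complex ^ 'd ^ 'd" where
  \<comment> \<open>the rank-one matrix $u u^*$ for a column vector $u$\<close>
  "outer_self u = (\<chi> i j. u $ i * cnj (u $ j))"

definition spectral_norm :: "complex ^ 'd ^ 'd \<Rightarrow> real" where
  \<comment> \<open>The type-class norm on matrices is the Frobenius norm, so the operator norm
      induced by the Euclidean norm on vectors is taken explicitly.\<close>
  "spectral_norm M = onorm (\<lambda>x. M *v x)"

end

theory Submission
  imports Defs "HOL-Computational_Algebra.Fundamental_Theorem_Algebra"
begin

text \<open>
  This is the interlacing-families argument of Marcus, Spielman and Srivastava, arranged so that
  only polynomials of degree one in each variable occur. Give every pair \<open>(i, k)\<close> of a vector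
  and a part its own variable and let \<open>H\<close> be the product over \<open>k\<close> of the determinants
  \<open>det (\<Sum>i. z (i, k) \<cdot> u i (u i)\<^sup>*)\<close>. Since the \<open>u i (u i)\<^sup>*\<close> sum to the identity, lowering
  \<open>z (i, k)\<close> by \<open>r\<close> from the diagonal point \<open>(x, \<dots>, x)\<close> amounts to putting \<open>u i\<close> into part \<open>k\<close>
  of \<open>det (x I - r \<Sum> u i (u i)\<^sup>*)\<close>. Averaging this operation over \<open>k\<close> is the operator
  \<open>1 - \<Sum>k. \<partial>\<^bsub>(i, k)\<^esub>\<close>, which preserves real stability.

  The barrier argument shows that the average over all partitions has no zero \<open>x \<ge> (1 + \<surd>(r \<delta>))\<^sup>2\<close>;
  the convexity it needs comes from a partial fraction expansion with nonnegative residues.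
  The parts are then chosen one vector at a time: all convex combinations of the candidate
  polynomials are real-rooted, so a candidate that is positive at this bound has no larger zero.
\<close>

section \<open>Polynomials with only real roots\<close>

text \<open>The barrier of variable \<open>j\<close> is the logarithmic derivative of
  \<open>H\<close> in that variable. The operator for vector \<open>i\<close> can move zeros
  outwards, but while the barriers of the \<open>r\<close> variables \<open>(i, k)\<close> sum to at
  most \<open>1 - 1 / dl\<close>, raising just these variables by \<open>dl\<close> brings every
  barrier back to at most its old value. The blocks of variables are disjoint, so each coordinate
  rises only once, from \<open>t\<close> to \<open>t + dl\<close>. At the diagonal point
  \<open>t\<close> the barrier of \<open>(i, k)\<close> is \<open>(norm (u i))\<^sup>2 / t\<close>,
  so the constraint is met once \<open>r \<delta> / t \<le> 1 - 1 / dl\<close>. With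
  \<open>e = sqrt (r \<delta>)\<close> the sum \<open>t + dl\<close> is then least at
  \<open>t = e + e\<^sup>2\<close> and \<open>dl = 1 + e\<close>, where it equals
  \<open>(1 + e)\<^sup>2\<close>. The delicate point is convexity along a block: the other
  coordinates stay real, so stability does not directly apply to the restriction to such a line.
  What survives the passage to the boundary is the sign of the imaginary part of a derivative over
  \<open>H\<close>, and the partial fractions are built from that sign alone.\<close>

definition cpoly :: "real poly \<Rightarrow> complex \<Rightarrow> complex" where
  "cpoly p z = poly (map_poly of_real p) z"

lemma cpoly_pCons [simp]: "cpoly (pCons a p) z = of_real a + z * cpoly p z"
  by (simp add: cpoly_def map_poly_pCons)

lemma cpoly_0 [simp]: "cpoly 0 z = 0"
  by (simp add: cpoly_def)

lemma cpoly_smult [simp]: "cpoly (smult c p) z = of_real c * cpoly p z"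
  by (induction p) (simp_all add: algebra_simps)

lemma cpoly_add [simp]: "cpoly (p + q) z = cpoly p z + cpoly q z"
  by (induction p q rule: poly_induct2) (simp_all add: algebra_simps)

lemma cpoly_diff [simp]: "cpoly (p - q) z = cpoly p z - cpoly q z"
  using cpoly_add[of "p - q" q z] by simp

lemma cpoly_mult [simp]: "cpoly (p * q) z = cpoly p z * cpoly q z"
  by (induction p) (simp_all add: algebra_simps)

lemma cpoly_1 [simp]: "cpoly 1 z = 1"
  by (simp add: one_pCons)

lemma cpoly_power [simp]: "cpoly (p ^ n) z = cpoly p z ^ n"
  by (induction n) simp_all

lemma cpoly_of_real [simp]: "cpoly p (of_real x) = of_real (poly p x)"
  by (induction p) simp_all

lemma cpoly_cnj: "cpoly p (cnj z) = cnj (cpoly p z)"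
  by (induction p) simp_all

lemma continuous_cpoly [continuous_intros]:
  "continuous F f \<Longrightarrow> continuous F (\<lambda>x. cpoly p (f x))"
  unfolding cpoly_def by (rule continuous_poly)

lemma isCont_cpoly: "isCont (cpoly p) z"
  using continuous_cpoly[of "at z" "\<lambda>x. x" p] by simp

lemma poly_eq_if_infinitely_many:
  fixes p q :: "'a::idom poly"
  assumes "infinite {x. poly p x = poly q x}"
  shows "p = q"
proof (rule ccontr)
  assume "p \<noteq> q"
  then have "finite {x. poly (p - q) x = 0}"
    by (intro poly_roots_finite) simp
  then show False using assms by simp
qed

text \<open>On the real line the polynomial agrees with the one whose coefficients are conjugated,
  and infinitely many agreements force equality.\<close>

lemma real_on_reals_imp_real_poly:
  fixes p :: "complex poly"
  assumes "\<And>x::real. poly p (of_real x) \<in> \<real>"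
  obtains q where "p = map_poly of_real q"
proof -
  have "range complex_of_real \<subseteq> {z. poly p z = poly (map_poly cnj p) z}"
    using assms by (auto simp: Reals_cnj_iff)
  moreover have "infinite (range complex_of_real)"
    by (simp add: finite_image_iff inj_on_def infinite_UNIV_char_0)
  ultimately have "p = map_poly cnj p"
    using poly_eq_if_infinitely_many infinite_super by blast
  then have r: "cnj (coeff p n) = coeff p n" for n
    by (metis coeff_map_poly complex_cnj_zero)
  have "map_poly of_real (map_poly Re p) = p"
    by (rule poly_eqI) (use r in \<open>simp add: coeff_map_poly complex_eq_iff\<close>)
  then show ?thesis
    using that[of "map_poly Re p"] by simp
qed

text \<open>
  A pole of order \<open>k\<close> takes all arguments between \<open>- k * pi\<close> and \<open>0\<close> on a half-circle, so an
  upper bound for the imaginary part forces the pole to be simple with positive residue.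
\<close>

lemma simple_pole_if_Im_bounded:
  fixes g x0 :: real and k :: nat and G :: "complex \<Rightarrow> complex"
  assumes cont: "isCont G x0" and G0: "G x0 = of_real g" and "g \<noteq> 0" and "k \<ge> 1" and e: "e > 0"
    and bd: "\<And>w. Im w > 0 \<Longrightarrow> cmod (w - x0) < e \<Longrightarrow> Im (G w / (w - x0) ^ k) \<le> M"
  shows "g > 0 \<and> k = 1"
proof -
  \<comment> \<open>Approach \<open>x0\<close> along the ray of angle \<open>\<phi>\<close>: after
    multiplication by \<open>s ^ k\<close> the bound \<open>M\<close> disappears as \<open>s\<close>
    tends to 0, and what remains is a sign condition on the leading term.\<close>
  have dir: "g * sin (real k * \<phi>) \<ge> 0" if \<phi>: "0 < \<phi>" "\<phi> < pi" for \<phi>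
  proof -
    define w where "w s = of_real x0 + of_real s * cis \<phi>" for s :: real
    have tend: "((\<lambda>s. Im (G (w s) * cis (- (real k * \<phi>)))) \<longlongrightarrow> Im (G x0 * cis (- (real k * \<phi>)))) (at_right 0)"
    proof (intro tendsto_intros isCont_tendsto_compose[OF cont])
      have "(w \<longlongrightarrow> of_real x0 + of_real 0 * cis \<phi>) (at_right 0)"
        unfolding w_def by (intro tendsto_intros)
      then show "(w \<longlongrightarrow> of_real x0) (at_right 0)" by simp
    qed
    have tend2: "((\<lambda>s. M * s ^ k) \<longlongrightarrow> M * 0 ^ k) (at_right (0::real))"
      by (intro tendsto_intros)
    have "eventually (\<lambda>s::real. s \<in> {0<..<e}) (at_right 0)"
      using e by (rule eventually_at_right_real)
    then have ev: "eventually (\<lambda>s. Im (G (w s) * cis (- (real k * \<phi>))) \<le> M * s ^ k) (at_right 0)"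
    proof eventually_elim
      case (elim s)
      have "Im (w s) > 0"
        using elim \<phi> by (simp add: w_def sin_gt_zero)
      moreover have "cmod (w s - x0) < e"
        using elim by (simp add: w_def norm_mult)
      ultimately have "Im (G (w s) / (w s - x0) ^ k) \<le> M" by (rule bd)
      moreover have "(w s - x0) ^ k = of_real (s ^ k) * cis (real k * \<phi>)"
        using Complex.DeMoivre[of \<phi> k] by (simp add: w_def power_mult_distrib)
      then have "G (w s) / (w s - x0) ^ k = G (w s) * cis (- (real k * \<phi>)) / of_real (s ^ k)"
        by (simp add: field_simps cis_mult flip: cis_inverse divide_inverse)
      ultimately show ?case
        using elim by (simp add: Im_divide_of_real pos_divide_le_eq del: of_real_power)
    qed
    have "Im (G x0 * cis (- (real k * \<phi>))) \<le> M * 0 ^ k"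
      by (rule tendsto_le[OF _ tend2 tend ev]) simp
    then show ?thesis using G0 \<open>k \<ge> 1\<close> by (simp add: zero_power)
  qed
  have "g \<ge> 0"
  proof -
    have "g * sin (real k * (pi / (2 * real k))) \<ge> 0"
      using \<open>k \<ge> 1\<close> by (intro dir) (auto simp: field_simps)
    moreover have "real k * (pi / (2 * real k)) = pi / 2" using \<open>k \<ge> 1\<close> by (simp add: field_simps)
    ultimately show ?thesis by (metis sin_pi_half mult_1_right)
  qed
  moreover have "k = 1"
  proof (rule ccontr)
    assume "k \<noteq> 1"
    with \<open>k \<ge> 1\<close> have k2: "k \<ge> 2" by simp
    \<comment> \<open>For \<open>k \<ge> 2\<close> this angle is still below \<open>pi\<close>, and
      the sine is -1 there.\<close>
    have "g * sin (real k * (3 * pi / (2 * real k))) \<ge> 0"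
      using k2 by (intro dir) (auto simp: field_simps)
    moreover have "real k * (3 * pi / (2 * real k)) = 3 / 2 * pi" using k2 by (simp add: field_simps)
    ultimately have "g * sin (3 / 2 * pi) \<ge> 0" by metis
    then have "g \<le> 0" by (simp only: sin_3over2_pi)
    with \<open>g \<ge> 0\<close> \<open>g \<noteq> 0\<close> show False by simp
  qed
  ultimately show ?thesis using \<open>g \<noteq> 0\<close> by simp
qed

text \<open>Roots of \<open>P\<close> are split off one at a time. If \<open>D\<close> vanishes
  there too, the factor cancels; otherwise the pole is simple with positive residue and its
  principal part is subtracted. The bound is assumed only near each root, with its own constant,
  because subtracting a principal part preserves such local bounds but not a uniform one.\<close>

lemma partial_fractions_if_Im_bounded:
  fixes P D :: "real poly"
  assumes "P \<noteq> 0" and "\<And>w. cpoly P w = 0 \<Longrightarrow> Im w = 0"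
    and "\<And>x. poly P x = 0 \<Longrightarrow>
           \<exists>M e. e > 0 \<and> (\<forall>w. Im w > 0 \<longrightarrow> cmod (w - of_real x) < e \<longrightarrow> Im (cpoly D w / cpoly P w) \<le> M)"
  shows "\<exists>E L. (\<forall>(a, x)\<in>set L. a \<ge> 0 \<and> poly P x = 0) \<and>
           (\<forall>x. poly P x \<noteq> 0 \<longrightarrow> poly D x / poly P x = poly E x + (\<Sum>(a, y)\<leftarrow>L. a / (x - y)))"
  using assms
proof (induction "degree P" arbitrary: P D rule: less_induct)
  case less
  show ?case
  proof (cases "degree P = 0")
    case True
    then obtain c where c: "P = [:c:]" by (meson degree_eq_zeroE)
    show ?thesis
      by (rule exI[of _ "smult (1 / c) D"], rule exI[of _ "[]"]) (simp add: c)
  next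
    case False
    have "degree (map_poly complex_of_real P) \<noteq> 0"
      using False by (simp add: degree_map_poly)
    then obtain z where z: "cpoly P z = 0"
      using alg_closed_imp_poly_has_root unfolding cpoly_def by blast
    define x0 where "x0 = Re z"
    have "z = of_real x0" using less.prems(2)[OF z] by (simp add: x0_def complex_eq_iff)
    with z have x0: "poly P x0 = 0" by simp
    then obtain P1 where P1: "P = [:- x0, 1:] * P1" by (metis poly_eq_0_iff_dvd dvdE)
    have P1nz: "P1 \<noteq> 0" using less.prems(1) P1 by auto
    then have degP1: "degree P1 < degree P" unfolding P1 by (subst degree_mult_eq) auto
    have rootsP1: "\<And>w. cpoly P1 w = 0 \<Longrightarrow> Im w = 0"
      using less.prems(2) by (simp add: P1)
    have cP: "cpoly P w = (w - x0) * cpoly P1 w" for w by (simp add: P1 algebra_simps)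
    have nonreal: "w \<noteq> of_real x" if "Im w > 0" for w x using that by auto
    show ?thesis
    proof (cases "poly D x0 = 0")
      case True
      then obtain D1 where D1: "D = [:- x0, 1:] * D1" by (metis poly_eq_0_iff_dvd dvdE)
      have "\<exists>M e. e > 0 \<and> (\<forall>w. Im w > 0 \<longrightarrow> cmod (w - of_real x) < e \<longrightarrow> Im (cpoly D1 w / cpoly P1 w) \<le> M)"
        if "poly P1 x = 0" for x
      proof -
        from that have "poly P x = 0" by (simp add: P1)
        from less.prems(3)[OF this] obtain M e where Me: "e > 0"
          "\<And>w. Im w > 0 \<Longrightarrow> cmod (w - of_real x) < e \<Longrightarrow> Im (cpoly D w / cpoly P w) \<le> M" by blast
        have "cpoly D w / cpoly P w = cpoly D1 w / cpoly P1 w" if "Im w > 0" for w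
          using nonreal[OF that, of x0] unfolding cP D1 by (simp flip: left_diff_distrib)
        with Me show ?thesis by metis
      qed
      from less.hyps[OF degP1 P1nz rootsP1 this] obtain E L where
        EL: "\<forall>(a, x)\<in>set L. a \<ge> 0 \<and> poly P1 x = 0"
        "\<forall>x. poly P1 x \<noteq> 0 \<longrightarrow> poly D1 x / poly P1 x = poly E x + (\<Sum>(a, y)\<leftarrow>L. a / (x - y))" by blast
      have "poly D x / poly P x = poly D1 x / poly P1 x" if "poly P x \<noteq> 0" for x
        using that by (simp add: P1 D1 flip: left_diff_distrib)
      then show ?thesis
        by (intro exI[of _ E] exI[of _ L]) (use EL in \<open>auto simp: P1\<close>)
    next
      case Dx0: False
      define k where "k = order x0 P1"
      obtain P2 where P2: "P1 = [:- x0, 1:] ^ k * P2" "\<not> [:- x0, 1:] dvd P2"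
        using order_decomp[OF P1nz] unfolding k_def by blast
      have P2x: "poly P2 x0 \<noteq> 0" using P2(2) by (simp add: poly_eq_0_iff_dvd)
      define g where "g = poly D x0 / poly P2 x0"
      have cP2: "cpoly P w = (w - x0) ^ Suc k * cpoly P2 w" for w by (simp add: P1 P2 algebra_simps)
      obtain M e where Me: "e > 0"
          "\<And>w. Im w > 0 \<Longrightarrow> cmod (w - of_real x0) < e \<Longrightarrow> Im (cpoly D w / cpoly P w) \<le> M"
        using less.prems(3)[OF x0] by blast
      have "g > 0 \<and> Suc k = 1"
      proof (rule simple_pole_if_Im_bounded[where G = "\<lambda>w. cpoly D w / cpoly P2 w" and e = e and M = M and ?x0.0 = x0])
        show "isCont (\<lambda>w. cpoly D w / cpoly P2 w) (of_real x0)"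
          using P2x by (intro continuous_intros isCont_cpoly) simp
        show "Im (cpoly D w / cpoly P2 w / (w - of_real x0) ^ Suc k) \<le> M"
          if "Im w > 0" "cmod (w - of_real x0) < e" for w
          using Me(2)[OF that] unfolding cP2 by (simp add: divide_divide_eq_left mult.commute)
      qed (use P2x Dx0 Me(1) in \<open>auto simp: g_def\<close>)
      then have g: "g > 0" and k: "k = 0" by auto
      have P1x: "poly P1 x0 \<noteq> 0" using P2 P2x k by simp
      have P12: "P2 = P1" using P2 k by simp
      \<comment> \<open>Taking away \<open>g / (x - x0)\<close> leaves \<open>D1 / P1\<close>, whose
        denominator has smaller degree.\<close>
      have "poly (D - smult g P1) x0 = 0" using P1x by (simp add: g_def P12)
      then obtain D1 where D1: "D - smult g P1 = [:- x0, 1:] * D1" by (metis poly_eq_0_iff_dvd dvdE)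
      have D1': "D = smult g P1 + [:- x0, 1:] * D1" using D1 by (simp add: algebra_simps)
      have "\<exists>M e. e > 0 \<and> (\<forall>w. Im w > 0 \<longrightarrow> cmod (w - of_real x) < e \<longrightarrow> Im (cpoly D1 w / cpoly P1 w) \<le> M)"
        if x: "poly P1 x = 0" for x
      proof -
        from that have "poly P x = 0" by (simp add: P1)
        from less.prems(3)[OF this] obtain M e where Me: "e > 0"
          "\<And>w. Im w > 0 \<Longrightarrow> cmod (w - of_real x) < e \<Longrightarrow> Im (cpoly D w / cpoly P w) \<le> M" by blast
        \<comment> \<open>Within distance \<open>d\<close> of \<open>x\<close> the subtracted term
          has modulus at most \<open>g / d\<close>, so the local bound survives as
          \<open>M + g / d\<close>.\<close>
        define d where "d = \<bar>x - x0\<bar> / 2"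
        have d: "d > 0" using x P1x by (auto simp: d_def)
        show ?thesis
        proof (rule exI[of _ "M + g / d"], rule exI[of _ "min e d"], intro conjI allI impI)
          fix w assume w: "Im w > 0" "cmod (w - of_real x) < min e d"
          have wx0: "w - x0 \<noteq> 0" and P1w: "cpoly P1 w \<noteq> 0"
            using nonreal[OF w(1)] rootsP1[of w] w(1) by auto
          have "\<bar>x - x0\<bar> \<le> cmod (w - x0) + cmod (w - x)"
            using norm_triangle_ineq4[of "w - x0" "w - x"]
            by (simp flip: of_real_diff add: norm_of_real)
          then have "d \<le> cmod (w - x0)" using w(2) by (simp add: d_def)
          then have "cmod (of_real g / (w - x0)) \<le> g / d"
            using g d by (simp add: norm_divide frac_le)
          have "cpoly D w / cpoly P w = of_real g / (w - x0) + cpoly D1 w / cpoly P1 w"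
            unfolding cP D1' using wx0 P1w by (simp add: field_simps)
          then have "Im (cpoly D1 w / cpoly P1 w) = Im (cpoly D w / cpoly P w) - Im (of_real g / (w - x0))"
            by simp
          also have "\<dots> \<le> M + cmod (of_real g / (w - x0))"
            using Me(2)[OF w(1)] w(2) abs_Im_le_cmod[of "of_real g / (w - x0)"] by force
          also have "\<dots> \<le> M + g / d"
            using \<open>cmod (of_real g / (w - x0)) \<le> g / d\<close> by simp
          finally show "Im (cpoly D1 w / cpoly P1 w) \<le> M + g / d" .
        qed (use Me(1) d in auto)
      qed
      from less.hyps[OF degP1 P1nz rootsP1 this] obtain E L where
        EL: "\<forall>(a, x)\<in>set L. a \<ge> 0 \<and> poly P1 x = 0"
        "\<forall>x. poly P1 x \<noteq> 0 \<longrightarrow> poly D1 x / poly P1 x = poly E x + (\<Sum>(a, y)\<leftarrow>L. a / (x - y))" by blast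
      have "poly D x / poly P x = g / (x - x0) + poly D1 x / poly P1 x" if "poly P x \<noteq> 0" for x
        using that by (simp add: P1 D1' field_simps)
      then show ?thesis
        by (intro exI[of _ E] exI[of _ "(g, x0) # L"]) (use EL g in \<open>auto simp: P1\<close>)
    qed
  qed
qed

section \<open>Convexity of sums of simple fractions\<close>

lemma poly_const_if_bounded:
  fixes E :: "real poly"
  assumes "\<And>x. x \<ge> 0 \<Longrightarrow> \<bar>poly E x\<bar> \<le> C"
  obtains e where "E = [:e:]"
proof (cases E)
  case (pCons e q)
  have "q = 0"
  proof (rule ccontr)
    assume "q \<noteq> 0"
    from poly_infinity[OF this, of "C + 1" e] obtain r
      where r: "\<And>z. r \<le> norm z \<Longrightarrow> C + 1 \<le> norm (poly E z)"
      using pCons by blast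
    from r[of "\<bar>r\<bar>"] assms[of "\<bar>r\<bar>"] show False by (simp add: abs_ge_self)
  qed
  with pCons that show ?thesis by blast
qed

text \<open>The last clause is convexity in the only form needed: the tangent at \<open>x\<close>,
  evaluated at 0, lies below the graph. All clauses are additive in \<open>L\<close>, so one
  induction reduces them to a single fraction.\<close>

lemma simple_fractions_bounds:
  assumes "\<forall>(a, y)\<in>set L. a \<ge> 0 \<and> y < (0::real)" and "x \<ge> 0"
  shows "0 \<le> (\<Sum>(a, y)\<leftarrow>L. a / (x - y))"
    and "(\<Sum>(a, y)\<leftarrow>L. a / (x - y)) \<le> (\<Sum>(a, y)\<leftarrow>L. a / (0 - y))"
    and "((\<lambda>x. \<Sum>(a, y)\<leftarrow>L. a / (x - y)) has_real_derivative (\<Sum>(a, y)\<leftarrow>L. - a / (x - y)\<^sup>2)) (at x)"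
    and "(\<Sum>(a, y)\<leftarrow>L. - a / (x - y)\<^sup>2) \<le> 0"
    and "(\<Sum>(a, y)\<leftarrow>L. a / (x - y)) - x * (\<Sum>(a, y)\<leftarrow>L. - a / (x - y)\<^sup>2)
           \<le> (\<Sum>(a, y)\<leftarrow>L. a / (0 - y))"
proof -
  have "0 \<le> (\<Sum>(a, y)\<leftarrow>L. a / (x - y)) \<and>
    (\<Sum>(a, y)\<leftarrow>L. a / (x - y)) \<le> (\<Sum>(a, y)\<leftarrow>L. a / (0 - y)) \<and>
    ((\<lambda>x. \<Sum>(a, y)\<leftarrow>L. a / (x - y)) has_real_derivative (\<Sum>(a, y)\<leftarrow>L. - a / (x - y)\<^sup>2)) (at x) \<and>
    (\<Sum>(a, y)\<leftarrow>L. - a / (x - y)\<^sup>2) \<le> 0 \<and>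
    (\<Sum>(a, y)\<leftarrow>L. a / (x - y)) - x * (\<Sum>(a, y)\<leftarrow>L. - a / (x - y)\<^sup>2) \<le> (\<Sum>(a, y)\<leftarrow>L. a / (0 - y))"
    using assms(1)
  proof (induction L)
    case Nil
    then show ?case by simp
  next
    case (Cons l L)
    obtain a y where l: "l = (a, y)" by force
    have a: "a \<ge> 0" and y: "y < 0" using Cons.prems l by auto
    define b where "b = - y"
    have b: "b > 0" and yb: "y = - b" using y by (auto simp: b_def)
    have 1: "0 \<le> a / (x - y)" "a / (x - y) \<le> a / (0 - y)" "- a / (x - y)\<^sup>2 \<le> 0"
      using a y \<open>x \<ge> 0\<close> frac_le[of a a "0 - y" "x - y"] by simp_all
    have "1 / (x + b) + x / (x + b)\<^sup>2 \<le> 1 / b"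
    proof -
      have "1 / b - 1 / (x + b) - x / (x + b)\<^sup>2 = x\<^sup>2 / (b * (x + b)\<^sup>2)"
        using b \<open>x \<ge> 0\<close> by (simp add: divide_simps) (simp add: power2_eq_square algebra_simps)
      also have "\<dots> \<ge> 0" using b by simp
      finally show ?thesis by simp
    qed
    from mult_left_mono[OF this a] have 2: "a / (x - y) - x * (- a / (x - y)\<^sup>2) \<le> a / (0 - y)"
      by (simp add: yb algebra_simps)
    have 3: "((\<lambda>x. a / (x - y)) has_real_derivative (- a / (x - y)\<^sup>2)) (at x)"
      using y \<open>x \<ge> 0\<close> by (auto intro!: derivative_eq_intros simp: power2_eq_square)
    from Cons.prems have "\<forall>(a, y)\<in>set L. a \<ge> 0 \<and> y < 0" by simp
    note IH = Cons.IH[OF this]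
    show ?case
      unfolding l list.map sum_list.Cons prod.case distrib_left
      by (intro conjI DERIV_add[OF 3]) (use IH 1 2 in linarith)+
  qed
  then show "0 \<le> (\<Sum>(a, y)\<leftarrow>L. a / (x - y))"
    and "(\<Sum>(a, y)\<leftarrow>L. a / (x - y)) \<le> (\<Sum>(a, y)\<leftarrow>L. a / (0 - y))"
    and "((\<lambda>x. \<Sum>(a, y)\<leftarrow>L. a / (x - y)) has_real_derivative (\<Sum>(a, y)\<leftarrow>L. - a / (x - y)\<^sup>2)) (at x)"
    and "(\<Sum>(a, y)\<leftarrow>L. - a / (x - y)\<^sup>2) \<le> 0"
    and "(\<Sum>(a, y)\<leftarrow>L. a / (x - y)) - x * (\<Sum>(a, y)\<leftarrow>L. - a / (x - y)\<^sup>2)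
           \<le> (\<Sum>(a, y)\<leftarrow>L. a / (0 - y))" by blast+
qed

text \<open>
  The quotient \<open>F = d / p\<close> is convex and nonincreasing to the right of the roots of \<open>p\<close>, and the
  left-hand side below equals \<open>F s - F' s / (1 - p' s / p s)\<close>.
\<close>

lemma univariate_barrier_shift:
  fixes p d :: "real poly"
  assumes s: "s > 0" and pos: "\<And>x. x \<ge> 0 \<Longrightarrow> poly p x > 0"
    and rep: "\<forall>(a, y)\<in>set L. a \<ge> 0 \<and> poly p y = 0"
      "\<And>x. poly p x \<noteq> 0 \<Longrightarrow> poly d x / poly p x = poly E x + (\<Sum>(a, y)\<leftarrow>L. a / (x - y))"
    and bd: "\<And>x. x \<ge> 0 \<Longrightarrow> 0 \<le> poly d x \<and> poly d x / poly p x \<le> C"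
    and bar: "poly (pderiv p) s / poly p s \<le> 1 - 1 / s"
  shows "poly (d - pderiv d) s / poly (p - pderiv p) s \<le> poly d 0 / poly p 0"
proof -
  have L: "\<forall>(a, y)\<in>set L. a \<ge> 0 \<and> y < 0"
    using rep(1) pos by (smt (verit) case_prodD case_prodI2)
  note SB = simple_fractions_bounds[OF L]
  define S where "S x = (\<Sum>(a, y)\<leftarrow>L. a / (x - y))" for x
  define S' where "S' = (\<Sum>(a, y)\<leftarrow>L. - a / (s - y)\<^sup>2)"
  have F: "poly d x / poly p x = poly E x + S x" if "x \<ge> 0" for x
    using rep(2)[of x] pos[OF that] by (simp add: S_def)
  \<comment> \<open>Both \<open>d / p\<close> and the sum of fractions are bounded for
    \<open>x \<ge> 0\<close>; hence the polynomial part is bounded too and must be constant.\<close>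
  have "\<bar>poly E x\<bar> \<le> \<bar>C\<bar> + S 0" if x: "x \<ge> 0" for x
  proof -
    have "0 \<le> S x" "S x \<le> S 0" using SB(1,2)[OF x] by (auto simp: S_def)
    moreover have "0 \<le> poly d x / poly p x" "poly d x / poly p x \<le> C"
      using bd[OF x] pos[OF x] by auto
    ultimately show ?thesis using F[OF x] by linarith
  qed
  then obtain e where e: "E = [:e:]" by (rule poly_const_if_bounded)
  have ps: "poly p s > 0" using pos s by simp
  have S'0: "S' \<le> 0" using SB(4)[of s] s by (simp add: S'_def)
  have conv: "S s - s * S' \<le> S 0" using SB(5)[of s] s by (simp add: S'_def S_def)
  have "((\<lambda>x. e + S x) has_real_derivative 0 + S') (at s)"
    using SB(3)[of s] s unfolding S_def S'_def by (intro derivative_intros) auto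
  moreover have "((\<lambda>x. poly d x / poly p x) has_real_derivative
      (poly (pderiv d) s * poly p s - poly d s * poly (pderiv p) s) / (poly p s * poly p s)) (at s)"
    using ps by (intro DERIV_divide poly_DERIV) auto
  moreover have "eventually (\<lambda>x. x > 0) (nhds s)"
    using s by (intro eventually_nhds_in_open[of "{0<..}", simplified]) auto
  then have "eventually (\<lambda>x. e + S x = poly d x / poly p x) (nhds s)"
    by eventually_elim (use F e in auto)
  ultimately have "(poly (pderiv d) s * poly p s - poly d s * poly (pderiv p) s) / (poly p s * poly p s) = S'"
    using DERIV_unique DERIV_cong_ev[of s s "\<lambda>x. e + S x" "\<lambda>x. poly d x / poly p x"] by force
  then have dd: "poly (pderiv d) s = S' * poly p s + poly d s / poly p s * poly (pderiv p) s"
    using ps by (simp add: field_simps)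
  \<comment> \<open>The barrier bound gives \<open>1 / q \<le> s\<close>, so the correction
    \<open>- S' / q\<close> is at most \<open>- s * S'\<close>, the amount by which the tangent at
    \<open>s\<close> rises on the way back to 0.\<close>
  define q where "q = 1 - poly (pderiv p) s / poly p s"
  have q: "1 / s \<le> q" using bar by (simp add: q_def)
  then have qpos: "q > 0" using s by (smt (verit) divide_pos_pos)
  have "poly (p - pderiv p) s = q * poly p s" using ps by (simp add: q_def field_simps)
  moreover have "poly (d - pderiv d) s = ((e + S s) * q - S') * poly p s"
    using F[of s] s ps e by (simp add: dd q_def field_simps)
  ultimately have "poly (d - pderiv d) s / poly (p - pderiv p) s = ((e + S s) * q - S') / q"
    using ps by simp
  also have "\<dots> = (e + S s) - S' / q"
    using qpos by (simp add: field_simps)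
  also have "- S' / q \<le> - S' * s"
  proof -
    have "1 / q \<le> s" using q qpos s by (simp add: field_simps)
    from mult_left_mono[OF this, of "- S'"] S'0 show ?thesis by simp
  qed
  then have "(e + S s) - S' / q \<le> e + (S s - s * S')" by (simp add: algebra_simps)
  also have "\<dots> \<le> e + S 0" using conv by simp
  also have "\<dots> = poly d 0 / poly p 0" using F[of 0] e by simp
  finally show ?thesis .
qed

section \<open>Real stable multi-affine polynomials\<close>

text \<open>For a function of degree one in the variable \<open>j\<close> this is the partial derivative.\<close>

definition pd :: "'i \<Rightarrow> (('i \<Rightarrow> complex) \<Rightarrow> complex) \<Rightarrow> ('i \<Rightarrow> complex) \<Rightarrow> complex" where
  "pd j H Z = H (Z(j := 1)) - H (Z(j := 0))"

definition shift :: "real \<Rightarrow> 'i \<Rightarrow> (('i \<Rightarrow> complex) \<Rightarrow> complex) \<Rightarrow> ('i \<Rightarrow> complex) \<Rightarrow> complex" where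
  "shift s j H Z = H (Z(j := Z j - of_real s))"

text \<open>Polynomials in many variables are handled as functions: those of degree at most one in
  each variable from \<open>J\<close> are characterised by affine behaviour in each coordinate and
  independence of all others, so coefficients never appear.\<close>

definition multiaffine :: "'i set \<Rightarrow> (('i \<Rightarrow> complex) \<Rightarrow> complex) \<Rightarrow> bool" where
  "multiaffine J H \<longleftrightarrow>
     (\<forall>j\<in>J. \<forall>Z w. H (Z(j := w)) = H (Z(j := 0)) + w * pd j H Z) \<and>
     (\<forall>Z Z'. (\<forall>j\<in>J. Z j = Z' j) \<longrightarrow> H Z = H Z')"

lemma multiaffine_cong: "multiaffine J H \<Longrightarrow> (\<And>j. j \<in> J \<Longrightarrow> Z j = Z' j) \<Longrightarrow> H Z = H Z'"
  unfolding multiaffine_def by blast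

lemma multiaffine_upd:
  assumes "multiaffine J H" "j \<in> J"
  shows "H (Z(j := w)) = H Z + (w - Z j) * pd j H Z"
proof -
  have "H (Z(j := w)) = H (Z(j := 0)) + w * pd j H Z" for w
    using assms unfolding multiaffine_def by blast
  from this[of w] this[of "Z j"] show ?thesis by (simp add: algebra_simps)
qed

lemma pd_upd_same [simp]: "pd j H (Z(j := w)) = pd j H Z"
  by (simp add: pd_def)

lemma pd_pd_same [simp]: "pd j (pd j H) Z = 0"
  by (simp add: pd_def)

lemma pd_commute: "pd j (pd l H) = pd l (pd j H)"
proof (cases "j = l")
  case False
  show ?thesis
    by (rule ext) (simp add: pd_def fun_upd_twist[OF False])
qed simp

lemma multiaffineI:
  assumes "\<And>j Z w. j \<in> J \<Longrightarrow> H (Z(j := w)) = H Z + (w - Z j) * pd j H Z"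
    and "\<And>Z Z'. (\<forall>j\<in>J. Z j = Z' j) \<Longrightarrow> H Z = H Z'"
  shows "multiaffine J H"
  unfolding multiaffine_def
proof (intro conjI ballI allI impI)
  fix j Z w assume j: "j \<in> J"
  show "H (Z(j := w)) = H (Z(j := 0)) + w * pd j H Z"
    unfolding assms(1)[OF j, of Z w] assms(1)[OF j, of Z 0] by (simp add: algebra_simps)
qed (use assms(2) in blast)

lemma multiaffine_pd:
  assumes "multiaffine J H"
  shows "multiaffine J (pd l H)"
proof (rule multiaffineI)
  fix j Z w assume j: "j \<in> J"
  show "pd l H (Z(j := w)) = pd l H Z + (w - Z j) * pd j (pd l H) Z"
  proof (cases "j = l")
    case False
    have "pd l H (Z(j := w)) = H ((Z(l := 1))(j := w)) - H ((Z(l := 0))(j := w))"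
      using False by (simp add: pd_def fun_upd_twist[OF False])
    also have "\<dots> = pd l H Z + (w - Z j) * pd l (pd j H) Z"
      using False by (simp add: multiaffine_upd[OF assms j] pd_def[of l] algebra_simps)
    finally show ?thesis by (simp only: pd_commute)
  qed simp
next
  fix Z Z' :: "'a \<Rightarrow> complex" assume "\<forall>j\<in>J. Z j = Z' j"
  then show "pd l H Z = pd l H Z'"
    unfolding pd_def by (intro arg_cong2[where f = "(-)"] multiaffine_cong[OF assms]) auto
qed

lemma pd_sum: "pd j (\<lambda>Z. \<Sum>k\<in>K. c k * F k Z) Z = (\<Sum>k\<in>K. c k * pd j (F k) Z)"
  by (simp add: pd_def sum_subtractf algebra_simps)

lemma multiaffine_sum:
  assumes "\<And>k. k \<in> K \<Longrightarrow> multiaffine J (F k)"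
  shows "multiaffine J (\<lambda>Z. \<Sum>k\<in>K. c k * F k Z)"
proof (rule multiaffineI)
  fix j Z w assume j: "j \<in> J"
  have "(\<Sum>k\<in>K. c k * F k (Z(j := w))) = (\<Sum>k\<in>K. c k * F k Z + (w - Z j) * (c k * pd j (F k) Z))"
    by (intro sum.cong refl) (simp add: multiaffine_upd[OF assms j] algebra_simps)
  then show "(\<Sum>k\<in>K. c k * F k (Z(j := w))) =
      (\<Sum>k\<in>K. c k * F k Z) + (w - Z j) * pd j (\<lambda>Z. \<Sum>k\<in>K. c k * F k Z) Z"
    by (simp add: pd_sum sum.distrib sum_distrib_left)
next
  fix Z Z' :: "'b \<Rightarrow> complex" assume "\<forall>j\<in>J. Z j = Z' j"
  then show "(\<Sum>k\<in>K. c k * F k Z) = (\<Sum>k\<in>K. c k * F k Z')"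
    by (intro sum.cong refl arg_cong2[where f = "(*)"] multiaffine_cong[OF assms]) auto
qed

lemma shift_eq:
  assumes "multiaffine J H" "j \<in> J"
  shows "shift s j H Z = H Z - of_real s * pd j H Z"
  by (simp add: shift_def multiaffine_upd[OF assms])

lemma multiaffine_shift:
  assumes "multiaffine J H" "l \<in> J"
  shows "multiaffine J (shift s l H)"
proof -
  \<comment> \<open>A two-term linear combination indexed by truth values, to fit
    \<open>multiaffine_sum\<close>.\<close>
  have "shift s l H = (\<lambda>Z. \<Sum>b\<in>{True, False}. (if b then 1 else - of_real s) * (if b then H else pd l H) Z)"
    by (simp add: fun_eq_iff shift_eq[OF assms])
  moreover have "multiaffine J \<dots>"
    by (rule multiaffine_sum) (use assms multiaffine_pd in auto)
  ultimately show ?thesis by metis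
qed

lemma pd_shift:
  assumes "multiaffine J H" "l \<in> J"
  shows "pd j (shift s l H) Z = pd j H Z - of_real s * pd l (pd j H) Z"
proof -
  have "pd j (shift s l H) Z = pd j H Z - of_real s * pd j (pd l H) Z"
    by (simp add: pd_def[of j] shift_eq[OF assms] algebra_simps)
  then show ?thesis by (simp only: pd_commute)
qed

text \<open>The bridge to univariate polynomials. Letting one more coordinate \<open>l\<close> move
  adds \<open>t * V l\<close> times the restriction of \<open>pd l H\<close>, whose constant term is
  the new contribution to the linear coefficient.\<close>

lemma multiaffine_line:
  assumes "finite K" "K \<subseteq> J" "multiaffine J H"
  obtains p where "\<And>t. H (\<lambda>j. if j \<in> K then Z j + t * V j else Z j) = poly p t"
    and "coeff p 1 = (\<Sum>j\<in>K. V j * pd j H Z)"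
proof -
  have "\<exists>p. (\<forall>t. H (\<lambda>j. if j \<in> K then Z j + t * V j else Z j) = poly p t) \<and>
      coeff p 1 = (\<Sum>j\<in>K. V j * pd j H Z)"
    using assms
  proof (induction K arbitrary: H rule: finite_induct)
    case empty
    then show ?case by (intro exI[of _ "[:H Z:]"]) simp
  next
    case (insert l K)
    then have l: "l \<in> J" and K: "K \<subseteq> J" by auto
    from insert.IH[OF K insert.prems(2)] obtain p where
      p: "\<And>t. H (\<lambda>j. if j \<in> K then Z j + t * V j else Z j) = poly p t"
        "coeff p 1 = (\<Sum>j\<in>K. V j * pd j H Z)" by blast
    from insert.IH[OF K multiaffine_pd[OF insert.prems(2), of l]] obtain q where
      q: "\<And>t. pd l H (\<lambda>j. if j \<in> K then Z j + t * V j else Z j) = poly q t" by blast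
    have "(\<lambda>j. if j \<in> K then Z j + 0 * V j else Z j) = Z" by auto
    then have "poly q 0 = pd l H Z" using q[of 0] by metis
    then have q0: "coeff q 0 = pd l H Z" by (simp add: poly_0_coeff_0)
    have "H (\<lambda>j. if j \<in> insert l K then Z j + t * V j else Z j) = poly (p + [:0, V l:] * q) t" for t
    proof -
      let ?Z = "\<lambda>j. if j \<in> K then Z j + t * V j else Z j"
      have "(\<lambda>j. if j \<in> insert l K then Z j + t * V j else Z j) = ?Z(l := Z l + t * V l)"
        by auto
      then have "H (\<lambda>j. if j \<in> insert l K then Z j + t * V j else Z j) = H (?Z(l := Z l + t * V l))"
        by (rule arg_cong)
      also have "\<dots> = H ?Z + (Z l + t * V l - ?Z l) * pd l H ?Z"
        by (rule multiaffine_upd[OF insert.prems(2) l])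
      also have "\<dots> = poly p t + t * V l * poly q t"
        unfolding p q using insert.hyps(2) by simp
      also have "\<dots> = poly (p + [:0, V l:] * q) t" by simp
      finally show ?thesis .
    qed
    moreover have "coeff (p + [:0, V l:] * q) 1 = (\<Sum>j\<in>insert l K. V j * pd j H Z)"
      using insert.hyps p(2) q0 by (simp add: coeff_pCons)
    ultimately show ?case by blast
  qed
  with that show thesis by blast
qed

lemma pderiv_at: "poly (pderiv p) w = coeff (pcompose p [:w, 1:]) 1"
proof -
  have "poly (pderiv (pcompose p [:w, 1:])) 0 = poly (pderiv p) w"
    by (simp add: pderiv_pcompose poly_pcompose pderiv_pCons)
  moreover have "poly (pderiv (pcompose p [:w, 1:])) 0 = coeff (pcompose p [:w, 1:]) 1"
    by (simp only: poly_0_coeff_0 coeff_pderiv) simp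
  ultimately show ?thesis by (simp only:)
qed

text \<open>Re-centring the line at \<open>w\<close> turns the derivative there into a linear
  coefficient.\<close>

lemma multiaffine_line_deriv:
  fixes p :: "complex poly"
  assumes "finite K" "K \<subseteq> J" "multiaffine J H"
    and p: "\<And>t. H (\<lambda>j. if j \<in> K then Z j + t * V j else Z j) = poly p t"
  shows "poly (pderiv p) w = (\<Sum>j\<in>K. V j * pd j H (\<lambda>j. if j \<in> K then Z j + w * V j else Z j))"
proof -
  let ?Z = "\<lambda>j. if j \<in> K then Z j + w * V j else Z j"
  obtain q where q: "\<And>t. H (\<lambda>j. if j \<in> K then ?Z j + t * V j else ?Z j) = poly q t"
    and q1: "coeff q 1 = (\<Sum>j\<in>K. V j * pd j H ?Z)"
    by (rule multiaffine_line[OF assms(1-3), where Z = ?Z and V = V]) (rule that)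
  have "poly q t = poly (pcompose p [:w, 1:]) t" for t
  proof -
    have "(\<lambda>j. if j \<in> K then ?Z j + t * V j else ?Z j) = (\<lambda>j. if j \<in> K then Z j + (w + t) * V j else Z j)"
      by (auto simp: algebra_simps)
    then have "poly q t = poly p (w + t)" using q[of t] p[of "w + t"] by simp
    then show ?thesis by (simp add: poly_pcompose)
  qed
  then have "poly q = poly (pcompose p [:w, 1:])" by blast
  then have "q = pcompose p [:w, 1:]" by (simp only: poly_eq_poly_eq_iff)
  with q1 show ?thesis unfolding pderiv_at by (simp only:)
qed

text \<open>Compatibility with conjugation expresses that the coefficients are real.\<close>

definition real_stable :: "'i set \<Rightarrow> (('i \<Rightarrow> complex) \<Rightarrow> complex) \<Rightarrow> bool" where
  "real_stable J H \<longleftrightarrow> finite J \<and> multiaffine J H \<and> (\<forall>Z. H (\<lambda>j. cnj (Z j)) = cnj (H Z)) \<and>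
     (\<forall>Z. (\<forall>j\<in>J. Im (Z j) > 0) \<longrightarrow> H Z \<noteq> 0)"

lemma real_stableD:
  assumes "real_stable J H"
  shows "finite J" "multiaffine J H" "H (\<lambda>j. cnj (Z j)) = cnj (H Z)"
    "(\<And>j. j \<in> J \<Longrightarrow> Im (Z j) > 0) \<Longrightarrow> H Z \<noteq> 0"
proof -
  have *: "finite J \<and> multiaffine J H \<and> (\<forall>Z. H (\<lambda>j. cnj (Z j)) = cnj (H Z)) \<and>
     (\<forall>Z. (\<forall>j\<in>J. Im (Z j) > 0) \<longrightarrow> H Z \<noteq> 0)"
    using assms unfolding real_stable_def .
  show "finite J" by (rule conjunct1[OF *])
  show "multiaffine J H" by (rule conjunct1[OF conjunct2[OF *]])
  show "H (\<lambda>j. cnj (Z j)) = cnj (H Z)"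
    by (rule spec[OF conjunct1[OF conjunct2[OF conjunct2[OF *]]]])
  show "H Z \<noteq> 0" if "\<And>j. j \<in> J \<Longrightarrow> Im (Z j) > 0"
    using spec[OF conjunct2[OF conjunct2[OF conjunct2[OF *]]], of Z] that by blast
qed

lemma pd_cnj:
  assumes "\<And>Z. H (\<lambda>j. cnj (Z j)) = cnj (H Z)"
  shows "pd j H (\<lambda>j. cnj (Z j)) = cnj (pd j H Z)"
proof -
  have "H ((\<lambda>j. cnj (Z j))(j := c)) = cnj (H (Z(j := c)))" if "cnj c = c" for c
  proof -
    have "(\<lambda>j. cnj (Z j))(j := c) = (\<lambda>i. cnj ((Z(j := c)) i))" using that by auto
    then show ?thesis by (simp only: assms)
  qed
  then show ?thesis unfolding pd_def by simp
qed

section \<open>Logarithmic derivatives in the upper half-plane\<close>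

lemma Im_complex_of_real_mult: "Im (of_real a * z) = a * Im z"
  by simp

lemma Im_inverse_neg:
  assumes "Im q > 0"
  shows "Im (1 / q) < 0"
proof -
  have "Im (1 / q) = - Im q / ((Re q)\<^sup>2 + (Im q)\<^sup>2)" by (simp add: Im_divide)
  also have "\<dots> < 0" using assms by (intro divide_neg_pos add_nonneg_pos) auto
  finally show ?thesis .
qed

text \<open>As an affine function of coordinate \<open>j\<close>, \<open>H\<close> has its zero at
  \<open>w\<close>. Stability keeps \<open>w\<close> out of the open upper half-plane, so
  \<open>H / pd j H\<close>, which is \<open>Z j - w\<close>, has positive imaginary part.\<close>

lemma Im_pd_neg:
  assumes "real_stable J H" "j \<in> J" "\<And>i. i \<in> J \<Longrightarrow> Im (Z i) > 0" "pd j H Z \<noteq> 0"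
  shows "Im (pd j H Z / H Z) < 0"
proof -
  note H = real_stableD[OF assms(1)]
  define w where "w = Z j - H Z / pd j H Z"
  have "H (Z(j := w)) = 0"
    using assms(4) by (simp add: multiaffine_upd[OF H(2) assms(2)] w_def)
  moreover have "H (Z(j := w)) \<noteq> 0" if "Im w > 0"
    by (rule H(4)) (use assms(3) that in auto)
  ultimately have "\<not> Im w > 0" by blast
  then have "Im (H Z / pd j H Z) > 0" using assms(3)[OF assms(2)] by (simp add: w_def)
  from Im_inverse_neg[OF this] show ?thesis by simp
qed

lemma Im_pd_nonpos:
  assumes "real_stable J H" "j \<in> J" "\<And>i. i \<in> J \<Longrightarrow> Im (Z i) > 0"
  shows "Im (pd j H Z / H Z) \<le> 0"
proof (cases "pd j H Z = 0")
  case False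
  with assms have "Im (pd j H Z / H Z) < 0" by (intro Im_pd_neg)
  then show ?thesis by simp
qed simp

text \<open>Weights are arbitrary because the choice of a part follows a path from the uniform
  weights to a single vertex.\<close>

definition average :: "real \<Rightarrow> 'i set \<Rightarrow> ('i \<Rightarrow> real) \<Rightarrow> (('i \<Rightarrow> complex) \<Rightarrow> complex) \<Rightarrow> ('i \<Rightarrow> complex) \<Rightarrow> complex" where
  "average s K c H Z = (\<Sum>k\<in>K. of_real (c k) * shift s k H Z)"

lemma average_eq:
  assumes "multiaffine J H" "K \<subseteq> J" "sum c K = 1"
  shows "average s K c H Z = H Z - of_real s * (\<Sum>k\<in>K. of_real (c k) * pd k H Z)"
proof -
  have "average s K c H Z = (\<Sum>k\<in>K. of_real (c k) * H Z - of_real s * (of_real (c k) * pd k H Z))"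
    unfolding average_def
    by (intro sum.cong refl) (use assms(2) in \<open>auto simp: shift_eq[OF assms(1)] right_diff_distrib\<close>)
  also have "\<dots> = of_real (sum c K) * H Z - of_real s * (\<Sum>k\<in>K. of_real (c k) * pd k H Z)"
    by (simp add: sum_subtractf sum_distrib_left sum_distrib_right)
  finally show ?thesis using assms(3) by simp
qed

lemma pd_average:
  assumes "multiaffine J H" "K \<subseteq> J" "sum c K = 1"
  shows "pd j (average s K c H) Z = average s K c (pd j H) Z"
proof -
  have "pd j (average s K c H) Z = (\<Sum>k\<in>K. of_real (c k) * pd j (shift s k H) Z)"
    unfolding average_def by (rule pd_sum)
  also have "\<dots> = (\<Sum>k\<in>K. of_real (c k) * shift s k (pd j H) Z)"
    by (intro sum.cong refl arg_cong2[where f = "(*)"])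
      (use assms(2) in \<open>auto simp: pd_shift[OF assms(1)] shift_eq[OF multiaffine_pd[OF assms(1)]]\<close>)
  finally show ?thesis by (simp add: average_def)
qed

text \<open>At a zero the weighted logarithmic derivatives would sum to the real number
  \<open>1 / s\<close>. Their imaginary parts are all nonpositive, so each must vanish; then every
  term with nonzero weight has derivative zero, and the sum is 0.\<close>

lemma real_stable_average:
  assumes H: "real_stable J H" and K: "K \<subseteq> J" and c: "\<And>k. k \<in> K \<Longrightarrow> c k \<ge> 0" "sum c K = 1"
    and s: "s > 0"
  shows "real_stable J (average s K c H)"
  unfolding real_stable_def
proof (intro conjI allI impI)
  note HD = real_stableD[OF H]
  show "finite J" by (rule HD)
  then have finK: "finite K" using K finite_subset by blast
  show "multiaffine J (average s K c H)"
    unfolding average_def using K by (intro multiaffine_sum multiaffine_shift HD) auto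
  fix Z
  show "average s K c H (\<lambda>j. cnj (Z j)) = cnj (average s K c H Z)"
    using pd_cnj[of H, OF HD(3)] by (simp add: average_eq[OF HD(2) K c(2)] HD(3))
  assume "\<forall>j\<in>J. 0 < Im (Z j)"
  then have Z: "\<And>j. j \<in> J \<Longrightarrow> Im (Z j) > 0" by blast
  then have HZ: "H Z \<noteq> 0" by (rule HD(4))
  show "average s K c H Z \<noteq> 0"
  proof
    assume "average s K c H Z = 0"
    then have "of_real s * (\<Sum>k\<in>K. of_real (c k) * (pd k H Z / H Z)) = 1"
      using HZ by (simp add: average_eq[OF HD(2) K c(2)] flip: sum_divide_distrib)
    then have eq: "(\<Sum>k\<in>K. of_real (c k) * (pd k H Z / H Z)) = of_real (1 / s)"
      using s by (simp add: field_simps)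
    have nonpos: "c k * Im (pd k H Z / H Z) \<le> 0" if "k \<in> K" for k
      using that K c(1) by (intro mult_nonneg_nonpos Im_pd_nonpos[OF H] Z) auto
    have "(\<Sum>k\<in>K. - (c k * Im (pd k H Z / H Z))) = - Im (\<Sum>k\<in>K. of_real (c k) * (pd k H Z / H Z))"
      unfolding Im_sum Im_complex_of_real_mult sum_negf ..
    also have "\<dots> = 0" unfolding eq by simp
    finally have "\<forall>k\<in>K. - (c k * Im (pd k H Z / H Z)) = 0"
      using nonpos by (subst (asm) sum_nonneg_eq_0_iff[OF finK]) auto
    then have "c k = 0 \<or> pd k H Z = 0" if "k \<in> K" for k
      using that K Im_pd_neg[OF H, of k Z] Z by force
    then have "(\<Sum>k\<in>K. of_real (c k) * (pd k H Z / H Z)) = 0"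
      by (intro sum.neutral) auto
    with eq s show False by simp
  qed
qed

lemma real_stable_shift:
  assumes H: "real_stable J H" and l: "l \<in> J"
  shows "real_stable J (shift s l H)"
  unfolding real_stable_def
proof (intro conjI allI impI)
  note HD = real_stableD[OF H]
  show "finite J" by (rule HD)
  show "multiaffine J (shift s l H)" using HD(2) l by (rule multiaffine_shift)
  fix Z
  show "shift s l H (\<lambda>j. cnj (Z j)) = cnj (shift s l H Z)"
    using pd_cnj[of H, OF HD(3)] by (simp add: shift_eq[OF HD(2) l] HD(3))
  assume "\<forall>j\<in>J. 0 < Im (Z j)"
  then show "shift s l H Z \<noteq> 0"
    unfolding shift_def by (intro HD(4)) auto
qed

text \<open>Limit of the open half-plane statement along \<open>Z + t * \<i>\<close>. The quotient
  is cleared to a product with the conjugate because \<open>H\<close> may vanish on the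
  boundary.\<close>

lemma Im_pd_nonpos_closed:
  assumes H: "real_stable J H" and j: "j \<in> J" and Z: "\<And>i. i \<in> J \<Longrightarrow> Im (Z i) \<ge> 0"
  shows "Im (pd j H Z * cnj (H Z)) \<le> 0"
proof -
  note HD = real_stableD[OF H]
  let ?Z = "\<lambda>t j. if j \<in> J then Z j + t * \<i> else Z j"
  obtain p where p: "\<And>t. H (?Z t) = poly p t"
    by (rule multiaffine_line[OF HD(1) subset_refl HD(2), where Z = Z and V = "\<lambda>_. \<i>"]) (rule that)
  obtain q where q: "\<And>t. pd j H (?Z t) = poly q t"
    by (rule multiaffine_line[OF HD(1) subset_refl multiaffine_pd[OF HD(2), of j], where Z = Z and V = "\<lambda>_. \<i>"]) (rule that)
  have "((\<lambda>t. Im (poly q (of_real t) * cnj (poly p (of_real t)))) \<longlongrightarrow>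
      Im (poly q (of_real 0) * cnj (poly p (of_real 0)))) (at_right 0)"
    by (intro tendsto_intros)
  moreover have "Im (poly q (of_real t) * cnj (poly p (of_real t))) \<le> 0" if "t > 0" for t
  proof -
    have "Im (pd j H (?Z t) / H (?Z t)) \<le> 0"
      using Z that by (intro Im_pd_nonpos[OF H j]) (auto simp: add_nonneg_pos)
    then have "Im (poly q t / poly p t) \<le> 0" by (simp add: p q)
    moreover have "Im (poly q t / poly p t) = Im (poly q t * cnj (poly p t)) / (cmod (poly p t))\<^sup>2"
      by (simp add: complex_div_cnj[of "poly q t"] flip: of_real_power)
    moreover have "poly p t \<noteq> 0"
      unfolding p[symmetric] by (rule HD(4)) (use Z that in \<open>auto simp: add_nonneg_pos\<close>)
    ultimately show ?thesis by (simp add: divide_le_0_iff)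
  qed
  then have "eventually (\<lambda>t. Im (poly q (of_real t) * cnj (poly p (of_real t))) \<le> 0) (at_right 0)"
    by (simp add: eventually_at_filter)
  ultimately have "Im (poly q (of_real 0) * cnj (poly p (of_real 0))) \<le> 0"
    by (intro tendsto_upperbound) auto
  moreover have "?Z 0 = Z" by auto
  ultimately show ?thesis using p[of 0] q[of 0] by simp
qed

section \<open>Barrier functions\<close>

text \<open>When \<open>H\<close> commutes with conjugation its value at a real point is real, so
  \<open>Re\<close> loses nothing.\<close>

definition rval :: "(('i \<Rightarrow> complex) \<Rightarrow> complex) \<Rightarrow> ('i \<Rightarrow> real) \<Rightarrow> real" where
  "rval H Z = Re (H (\<lambda>j. of_real (Z j)))"

definition above_roots :: "'i set \<Rightarrow> (('i \<Rightarrow> complex) \<Rightarrow> complex) \<Rightarrow> ('i \<Rightarrow> real) \<Rightarrow> bool" where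
  "above_roots J H Z0 \<longleftrightarrow> (\<forall>Z. (\<forall>j\<in>J. Z0 j \<le> Z j) \<longrightarrow> rval H Z > 0)"

definition barrier :: "'i \<Rightarrow> (('i \<Rightarrow> complex) \<Rightarrow> complex) \<Rightarrow> ('i \<Rightarrow> real) \<Rightarrow> real" where
  "barrier j H Z = rval (pd j H) Z / rval H Z"

lemma of_real_rval:
  assumes "\<And>Z. H (\<lambda>j. cnj (Z j)) = cnj (H Z)"
  shows "H (\<lambda>j. of_real (Z j)) = of_real (rval H Z)"
proof -
  have "H (\<lambda>j. of_real (Z j)) = cnj (H (\<lambda>j. of_real (Z j)))"
    using assms[of "\<lambda>j. of_real (Z j)"] by simp
  then show ?thesis unfolding rval_def by (metis Reals_cnj_iff of_real_Re)
qed

lemma rval_cong: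
  assumes "multiaffine J H" "\<And>j. j \<in> J \<Longrightarrow> Z j = Z' j"
  shows "rval H Z = rval H Z'"
  unfolding rval_def by (intro arg_cong[where f = Re] multiaffine_cong[OF assms(1)]) (simp add: assms(2))

lemma rval_upd:
  assumes "multiaffine J H" "j \<in> J"
  shows "rval H (Z(j := w)) = rval H Z + (w - Z j) * rval (pd j H) Z"
proof -
  have "(\<lambda>i. complex_of_real ((Z(j := w)) i)) = (\<lambda>i. of_real (Z i))(j := of_real w)" by auto
  then show ?thesis unfolding rval_def
    by (simp add: multiaffine_upd[OF assms] del: fun_upd_apply flip: of_real_diff)
qed

lemma rval_shift: "rval (shift s k H) Z = rval H (Z(k := Z k - s))"
proof -
  have "(\<lambda>j. complex_of_real ((Z(k := Z k - s)) j)) = (\<lambda>j. of_real (Z j))(k := of_real (Z k) - of_real s)"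
    by auto
  then show ?thesis by (simp add: rval_def shift_def)
qed

lemma above_rootsD: "above_roots J H Z0 \<Longrightarrow> (\<And>j. j \<in> J \<Longrightarrow> Z0 j \<le> Z j) \<Longrightarrow> rval H Z > 0"
  unfolding above_roots_def by blast

lemma above_roots_mono:
  assumes "above_roots J H Z0" "\<And>j. j \<in> J \<Longrightarrow> Z0 j \<le> Z j"
  shows "above_roots J H Z"
  unfolding above_roots_def
proof (intro allI impI)
  fix Z' assume "\<forall>j\<in>J. Z j \<le> Z' j"
  then show "rval H Z' > 0"
    by (intro above_rootsD[OF assms(1)]) (use assms(2) order_trans in blast)
qed

text \<open>With a negative slope in coordinate \<open>j\<close>, increasing that coordinate would
  reach a zero.\<close>

lemma rval_pd_nonneg:
  assumes H: "multiaffine J H" and j: "j \<in> J" and a: "above_roots J H Z"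
  shows "rval (pd j H) Z \<ge> 0"
proof (rule ccontr)
  assume neg: "\<not> rval (pd j H) Z \<ge> 0"
  have pos: "rval H Z > 0" by (rule above_rootsD[OF a]) simp
  define t where "t = - rval H Z / rval (pd j H) Z"
  have "t > 0" using neg pos by (simp add: t_def divide_pos_neg)
  then have "rval H (Z(j := Z j + t)) > 0" by (intro above_rootsD[OF a]) auto
  also have "rval H (Z(j := Z j + t)) = 0"
    using neg by (simp add: rval_upd[OF H j] t_def)
  finally show False by simp
qed

text \<open>The strongly Rayleigh inequality. Lift only coordinate \<open>l\<close> by the imaginary
  unit: the imaginary part of \<open>pd j H\<close> times the conjugate of \<open>H\<close> becomes
  exactly the difference of the two sides.\<close>

lemma rval_wronskian:
  assumes H: "real_stable J H" and j: "j \<in> J" and l: "l \<in> J"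
  shows "rval H Z * rval (pd l (pd j H)) Z \<le> rval (pd j H) Z * rval (pd l H) Z"
proof -
  note HD = real_stableD[OF H]
  let ?Z = "\<lambda>j. complex_of_real (Z j)"
  let ?W = "?Z(l := ?Z l + \<i>)"
  note pdD = pd_cnj[of H, OF HD(3)]
  have "Im (pd j H ?W * cnj (H ?W)) \<le> 0"
    by (rule Im_pd_nonpos_closed[OF H j]) simp
  moreover have "H ?W = of_real (rval H Z) + \<i> * of_real (rval (pd l H) Z)"
    unfolding multiaffine_upd[OF HD(2) l] of_real_rval[of H, OF HD(3)] of_real_rval[of "pd l H", OF pdD] by simp
  moreover have "pd j H ?W = of_real (rval (pd j H) Z) + \<i> * of_real (rval (pd l (pd j H)) Z)"
    unfolding multiaffine_upd[OF multiaffine_pd[OF HD(2)] l] of_real_rval[of "pd j H", OF pdD]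
      of_real_rval[of "pd l (pd j H)", OF pd_cnj[of "pd j H", OF pdD]] by simp
  ultimately show ?thesis by (simp add: algebra_simps)
qed

text \<open>Along coordinate \<open>l\<close> the barrier is a quotient of two affine functions, and
  the sign of their Wronskian decides its monotonicity.\<close>

lemma barrier_antimono_coord:
  assumes H: "real_stable J H" and j: "j \<in> J" and l: "l \<in> J" and a: "above_roots J H Z" and t: "t \<ge> 0"
  shows "barrier j H (Z(l := Z l + t)) \<le> barrier j H Z"
proof -
  note HD = real_stableD[OF H]
  define A B C D where "A = rval H Z" and "B = rval (pd l H) Z" and "C = rval (pd j H) Z"
    and "D = rval (pd l (pd j H)) Z"
  have AD: "A * D \<le> C * B" using rval_wronskian[OF H j l] by (simp add: A_def B_def C_def D_def)
  have A: "A > 0" unfolding A_def by (rule above_rootsD[OF a]) simp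
  have "rval H (Z(l := Z l + t)) > 0" by (rule above_rootsD[OF a]) (use t in auto)
  then have AB: "A + t * B > 0" by (simp add: rval_upd[OF HD(2) l] A_def B_def)
  have "barrier j H (Z(l := Z l + t)) = (C + t * D) / (A + t * B)"
    unfolding barrier_def rval_upd[OF HD(2) l] rval_upd[OF multiaffine_pd[OF HD(2)] l]
    by (simp add: A_def B_def C_def D_def)
  also have "\<dots> \<le> C / A"
    using A AB mult_left_mono[OF AD t] by (simp add: divide_simps) (simp add: algebra_simps)
  finally show ?thesis by (simp add: barrier_def A_def C_def)
qed

lemma barrier_antimono:
  assumes H: "real_stable J H" and j: "j \<in> J" and a: "above_roots J H Z0"
    and Z: "\<And>j. j \<in> J \<Longrightarrow> Z0 j \<le> Z j"
  shows "barrier j H Z \<le> barrier j H Z0"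
proof -
  note HD = real_stableD[OF H]
  have "barrier j H (\<lambda>i. if i \<in> K then Z i else Z0 i) \<le> barrier j H Z0" if "finite K" "K \<subseteq> J" for K
    using that
  proof (induction K rule: finite_induct)
    case (insert l K)
    let ?Z = "\<lambda>i. if i \<in> K then Z i else Z0 i"
    have l: "l \<in> J" using insert by blast
    have eq: "(\<lambda>i. if i \<in> insert l K then Z i else Z0 i) = ?Z(l := ?Z l + (Z l - Z0 l))"
      using insert.hyps by auto
    have "barrier j H (\<lambda>i. if i \<in> insert l K then Z i else Z0 i) \<le> barrier j H ?Z"
      unfolding eq
      by (rule barrier_antimono_coord[OF H j l above_roots_mono[OF a]]) (use Z l in auto)
    also have "\<dots> \<le> barrier j H Z0" using insert by blast
    finally show ?case .
  qed simp
  from this[OF HD(1) subset_refl] have "barrier j H (\<lambda>i. if i \<in> J then Z i else Z0 i) \<le> barrier j H Z0" .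
  moreover have "barrier j H (\<lambda>i. if i \<in> J then Z i else Z0 i) = barrier j H Z"
    unfolding barrier_def
    by (intro arg_cong2[where f = "(/)"] rval_cong[OF HD(2)] rval_cong[OF multiaffine_pd[OF HD(2)]]) auto
  ultimately show ?thesis by simp
qed

text \<open>Serves points with some real coordinates, where stability itself says nothing. Lifting
  one coordinate by \<open>y\<close> changes the squared modulus by
  \<open>y\<^sup>2 * (cmod b)\<^sup>2 - 2 * y * Im (b * cnj a)\<close>, and both contributions are
  nonnegative.\<close>

lemma cmod_mono_imaginary_direction:
  assumes H: "real_stable J H" and "finite K" "K \<subseteq> J" and y: "y \<ge> 0"
    and Z: "\<And>i. i \<in> J \<Longrightarrow> Im (Z i) \<ge> 0"
  shows "cmod (H Z) \<le> cmod (H (\<lambda>i. if i \<in> K then Z i + of_real y * \<i> else Z i))"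
  using assms(2,3)
proof (induction K rule: finite_induct)
  case (insert l K)
  note HD = real_stableD[OF H]
  let ?Z = "\<lambda>i. if i \<in> K then Z i + of_real y * \<i> else Z i"
  have l: "l \<in> J" using insert by blast
  have eq: "(\<lambda>i. if i \<in> insert l K then Z i + of_real y * \<i> else Z i) = ?Z(l := ?Z l + of_real y * \<i>)"
    using insert.hyps by auto
  define a b where "a = H ?Z" and "b = pd l H ?Z"
  have ab: "Im (b * cnj a) \<le> 0"
    unfolding a_def b_def by (rule Im_pd_nonpos_closed[OF H l]) (use Z y in auto)
  have "(cmod a)\<^sup>2 \<le> (cmod (a + of_real y * \<i> * b))\<^sup>2"
  proof -
    have "(cmod (a + of_real y * \<i> * b))\<^sup>2 = (cmod a)\<^sup>2 + y\<^sup>2 * (cmod b)\<^sup>2 - 2 * y * Im (b * cnj a)"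
      unfolding cmod_power2 by (simp add: power2_eq_square algebra_simps)
    moreover have "y * Im (b * cnj a) \<le> 0" using y ab by (rule mult_nonneg_nonpos)
    moreover have "y\<^sup>2 * (cmod b)\<^sup>2 \<ge> 0" by simp
    ultimately show ?thesis unfolding mult.assoc by linarith
  qed
  then have "cmod a \<le> cmod (a + of_real y * \<i> * b)" by (rule power2_le_imp_le) simp
  moreover have "H (?Z(l := ?Z l + of_real y * \<i>)) = a + of_real y * \<i> * b"
    unfolding multiaffine_upd[OF HD(2) l] a_def b_def by simp
  moreover have "cmod (H Z) \<le> cmod a" unfolding a_def using insert by blast
  ultimately show ?case unfolding eq by simp
qed simp

lemma poly_pderiv_map_of_real: "poly (pderiv (map_poly of_real p)) w = cpoly (pderiv p) w"
  by (induction p) (simp_all add: map_poly_pCons pderiv_pCons flip: cpoly_def)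

text \<open>Asks for multi-affinity and real coefficients rather than stability, so that it covers
  \<open>pd j H\<close> as well as \<open>H\<close>.\<close>

lemma real_stable_line:
  assumes H: "multiaffine J H" "\<And>Z. H (\<lambda>j. cnj (Z j)) = cnj (H Z)" and K: "finite K" "K \<subseteq> J"
  obtains p where "\<And>w. H (\<lambda>i. if i \<in> K then of_real (Z i) + w else of_real (Z i)) = cpoly p w"
    and "\<And>x. rval H (\<lambda>i. if i \<in> K then Z i + x else Z i) = poly p x"
    and "\<And>x. (\<Sum>k\<in>K. rval (pd k H) (\<lambda>i. if i \<in> K then Z i + x else Z i)) = poly (pderiv p) x"
proof -
  obtain q where q: "\<And>t. H (\<lambda>i. if i \<in> K then of_real (Z i) + t * 1 else of_real (Z i)) = poly q t"
    by (rule multiaffine_line[OF K H(1), where Z = "\<lambda>i. of_real (Z i)" and V = "\<lambda>_. 1"]) (rule that)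
  have eq: "(\<lambda>i. if i \<in> K then complex_of_real (Z i) + of_real x * 1 else of_real (Z i)) =
      (\<lambda>i. of_real (if i \<in> K then Z i + x else Z i))" for x by auto
  have qx: "poly q (of_real x) = of_real (rval H (\<lambda>i. if i \<in> K then Z i + x else Z i))" for x
    unfolding of_real_rval[of H, OF H(2), symmetric] eq[symmetric] q ..
  have "poly q (of_real x) \<in> \<real>" for x unfolding qx by (rule Reals_of_real)
  then obtain p where p: "q = map_poly of_real p" by (rule real_on_reals_imp_real_poly)
  show thesis
  proof (rule that[of p])
    show "H (\<lambda>i. if i \<in> K then of_real (Z i) + w else of_real (Z i)) = cpoly p w" for w
      using q[of w] unfolding p cpoly_def[symmetric] mult_1_right .
    show "rval H (\<lambda>i. if i \<in> K then Z i + x else Z i) = poly p x" for x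
      using qx[of x] unfolding p cpoly_def[symmetric] cpoly_of_real of_real_eq_iff ..
    show "(\<Sum>k\<in>K. rval (pd k H) (\<lambda>i. if i \<in> K then Z i + x else Z i)) = poly (pderiv p) x" for x
    proof -
      have pd_real: "pd k H (\<lambda>i. of_real (Y i)) = of_real (rval (pd k H) Y)" for k Y
        by (rule of_real_rval[of "pd k H", OF pd_cnj[of H, OF H(2)]])
      have "cpoly (pderiv p) (of_real x) =
          (\<Sum>k\<in>K. 1 * pd k H (\<lambda>i. if i \<in> K then of_real (Z i) + of_real x * 1 else of_real (Z i)))"
        unfolding poly_pderiv_map_of_real[symmetric] p[symmetric]
        by (rule multiaffine_line_deriv[OF K H(1) q])
      also have "\<dots> = of_real (\<Sum>k\<in>K. rval (pd k H) (\<lambda>i. if i \<in> K then Z i + x else Z i))"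
        unfolding eq pd_real by simp
      finally show ?thesis unfolding cpoly_of_real of_real_eq_iff ..
    qed
  qed
qed

text \<open>The shift length \<open>card K\<close> and the weights \<open>1 / card K\<close> cancel,
  so on multi-affine functions this is the identity minus the sum of the partial derivatives over
  \<open>K\<close>.\<close>

definition uaverage :: "'i set \<Rightarrow> (('i \<Rightarrow> complex) \<Rightarrow> complex) \<Rightarrow> ('i \<Rightarrow> complex) \<Rightarrow> complex" where
  "uaverage K = average (card K) K (\<lambda>_. 1 / card K)"

lemma real_stable_uaverage:
  assumes "real_stable J H" "K \<subseteq> J" "card K > 0"
  shows "real_stable J (uaverage K H)"
  unfolding uaverage_def by (rule real_stable_average) (use assms in auto)

lemma pd_uaverage:
  assumes "multiaffine J H" "K \<subseteq> J" "card K > 0"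
  shows "pd j (uaverage K H) = uaverage K (pd j H)"
  unfolding uaverage_def by (rule ext, rule pd_average) (use assms in auto)

lemma rval_uaverage:
  assumes "multiaffine J H" "K \<subseteq> J" "card K > 0"
  shows "rval (uaverage K H) Z = rval H Z - (\<Sum>k\<in>K. rval (pd k H) Z)"
proof -
  have c: "sum (\<lambda>_. 1 / real (card K)) K = 1" using assms(3) by simp
  show ?thesis
    using assms(3) unfolding uaverage_def rval_def average_eq[OF assms(1,2) c]
    by (simp flip: sum_distrib_left sum_divide_distrib)
qed

text \<open>On the line that raises all coordinates of \<open>K\<close> together, the sum of partial
  derivatives is \<open>d/dx\<close>, so \<open>uaverage\<close> sends the restrictions
  \<open>P\<close> of \<open>H\<close> and \<open>D\<close> of \<open>pd j H\<close> to
  \<open>P - P'\<close> and \<open>D - D'\<close>. This is the setting of the univariate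
  shift.\<close>

lemma barrier_uaverage_shift:
  fixes dl :: real
  assumes H: "real_stable J H" and K: "K \<subseteq> J" "card K > 0" and j: "j \<in> J"
    and a: "above_roots J H Z0" and dl: "dl > 0"
    and bar: "(\<Sum>k\<in>K. barrier k H Z0) \<le> 1 - 1 / dl"
  shows "barrier j (uaverage K H) (\<lambda>i. if i \<in> K then Z0 i + dl else Z0 i)
      \<le> barrier j H Z0"
proof -
  note HD = real_stableD[OF H]
  note MA = multiaffine_pd[OF HD(2)]
  note pdD = pd_cnj[of H, OF HD(3)]
  have finK: "finite K" using K(2) card_gt_0_iff by blast
  let ?Z = "\<lambda>x i. if i \<in> K then Z0 i + x else Z0 i"
  let ?W = "\<lambda>w i. if i \<in> K then complex_of_real (Z0 i) + w else of_real (Z0 i)"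
  obtain P where P: "\<And>w. H (?W w) = cpoly P w" "\<And>x. rval H (?Z x) = poly P x"
    "\<And>x. (\<Sum>k\<in>K. rval (pd k H) (?Z x)) = poly (pderiv P) x"
    by (rule real_stable_line[OF HD(2,3) finK K(1), where Z = Z0]) (rule that)
  obtain D where D: "\<And>w. pd j H (?W w) = cpoly D w" "\<And>x. rval (pd j H) (?Z x) = poly D x"
    "\<And>x. (\<Sum>k\<in>K. rval (pd k (pd j H)) (?Z x)) = poly (pderiv D) x"
    by (rule real_stable_line[OF MA[of j] pdD finK K(1), where Z = Z0]) (rule that)
  have ab: "above_roots J H (?Z x)" if "x \<ge> 0" for x
    by (rule above_roots_mono[OF a]) (use that in auto)
  have pos: "poly P x > 0" if "x \<ge> 0" for x
    unfolding P(2)[symmetric] by (rule above_rootsD[OF ab[OF that]]) simp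
  have Im0: "\<not> Im w > 0" if w: "cpoly P w = 0" for w
  proof
    assume Im: "Im w > 0"
    \<comment> \<open>Moduli grow upwards, so a zero \<open>w\<close> above the axis forces zeros on
      the whole vertical segment below it, and then \<open>P\<close> would be 0.\<close>
    have "cpoly P (of_real (Re w) + of_real y * \<i>) = 0" if y: "0 \<le> y" "y \<le> Im w" for y
    proof -
      let ?V = "?W (of_real (Re w) + of_real y * \<i>)"
      have "cmod (H ?V) \<le> cmod (H (\<lambda>i. if i \<in> K then ?V i + of_real (Im w - y) * \<i> else ?V i))"
        by (rule cmod_mono_imaginary_direction[OF H finK K(1)]) (use y in auto)
      also have "(\<lambda>i. if i \<in> K then ?V i + of_real (Im w - y) * \<i> else ?V i) = ?W w"
        by (auto simp: complex_eq_iff)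
      finally show ?thesis unfolding P(1) w by simp
    qed
    then have sub: "(\<lambda>y. of_real (Re w) + of_real y * \<i>) ` {0..Im w} \<subseteq> {z. cpoly P z = 0}" by auto
    have "infinite {0..Im w}" using Im by (rule infinite_Icc)
    then have "infinite ((\<lambda>y. of_real (Re w) + of_real y * \<i>) ` {0..Im w})"
      by (subst finite_image_iff) (auto simp: inj_on_def complex_eq_iff)
    with sub have "infinite {z. cpoly P z = 0}" using infinite_super by blast
    then have "map_poly complex_of_real P = 0"
      using poly_roots_finite unfolding cpoly_def by blast
    then have "cpoly P 0 = 0" by (simp add: cpoly_def)
    then show False using pos[of 0] cpoly_of_real[of P 0] by simp
  qed
  have real: "Im w = 0" if "cpoly P w = 0" for w
    using Im0[OF that] Im0[of "cnj w"] that by (simp add: cpoly_cnj)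
  have "P \<noteq> 0" using pos[of 0] by auto
  have Imle: "Im (cpoly D w / cpoly P w) \<le> 0" if "Im w > 0" for w
  proof -
    have "Im (pd j H (?W w) * cnj (H (?W w))) \<le> 0"
      by (rule Im_pd_nonpos_closed[OF H j]) (use that in auto)
    then have "Im (cpoly D w * cnj (cpoly P w)) / (cmod (cpoly P w))\<^sup>2 \<le> 0"
      unfolding P D by (simp add: divide_nonpos_nonneg)
    then show ?thesis
      by (simp add: complex_div_cnj[of "cpoly D w"] flip: of_real_power)
  qed
  obtain E L where EL: "\<forall>(a, x)\<in>set L. a \<ge> 0 \<and> poly P x = 0"
    "\<And>x. poly P x \<noteq> 0 \<Longrightarrow> poly D x / poly P x = poly E x + (\<Sum>(a, y)\<leftarrow>L. a / (x - y))"
    using partial_fractions_if_Im_bounded[OF \<open>P \<noteq> 0\<close> real, of D] Imle by (metis zero_less_one)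
  have bnd: "0 \<le> poly D x \<and> poly D x / poly P x \<le> barrier j H Z0" if x: "x \<ge> 0" for x
  proof
    show "0 \<le> poly D x" unfolding D(2)[symmetric] by (rule rval_pd_nonneg[OF HD(2) j ab[OF x]])
    have "barrier j H (?Z x) \<le> barrier j H Z0"
      by (rule barrier_antimono[OF H j a]) (use x in auto)
    then show "poly D x / poly P x \<le> barrier j H Z0" unfolding barrier_def P D .
  qed
  \<comment> \<open>The hypothesis bounds the barriers at \<open>Z0\<close>, while the univariate
    lemma needs them at the shifted point; monotonicity carries the bound over.\<close>
  have "poly (pderiv P) dl / poly P dl = (\<Sum>k\<in>K. barrier k H (?Z dl))"
    unfolding barrier_def P(2,3)[symmetric] sum_divide_distrib ..
  also have "\<dots> \<le> (\<Sum>k\<in>K. barrier k H Z0)"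
    by (intro sum_mono barrier_antimono[OF H _ a]) (use K dl in auto)
  also note bar
  finally have "poly (D - pderiv D) dl / poly (P - pderiv P) dl \<le> poly D 0 / poly P 0"
    by (intro univariate_barrier_shift[OF dl pos EL bnd])
  moreover have "poly D 0 / poly P 0 = barrier j H Z0"
  proof -
    have "?Z 0 = Z0" by auto
    then show ?thesis unfolding barrier_def D(2)[of 0, symmetric] P(2)[of 0, symmetric] by simp
  qed
  moreover have "rval (uaverage K H) (?Z dl) = poly (P - pderiv P) dl"
    unfolding rval_uaverage[OF HD(2) K] P by simp
  moreover have "rval (pd j (uaverage K H)) (?Z dl) = poly (D - pderiv D) dl"
    by (simp only: pd_uaverage[OF HD(2) K] rval_uaverage[OF MA K] D poly_diff)
  ultimately show ?thesis unfolding barrier_def[of j "uaverage _ _"] by simp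
qed

section \<open>Choosing a partition one vector at a time\<close>

text \<open>The new value is \<open>rval H Z\<close> times one minus the sum of the
  barriers.\<close>

lemma above_roots_uaverage:
  assumes H: "real_stable J H" and K: "K \<subseteq> J" "card K > 0" and a: "above_roots J H Z0"
    and bar: "(\<Sum>k\<in>K. barrier k H Z0) < 1"
  shows "above_roots J (uaverage K H) Z0"
  unfolding above_roots_def
proof (intro allI impI)
  note HD = real_stableD[OF H]
  fix Z assume Z: "\<forall>j\<in>J. Z0 j \<le> Z j"
  have pos: "rval H Z > 0" by (rule above_rootsD[OF a]) (use Z in blast)
  have "(\<Sum>k\<in>K. barrier k H Z) \<le> (\<Sum>k\<in>K. barrier k H Z0)"
    by (intro sum_mono barrier_antimono[OF H _ a]) (use Z K in auto)
  with bar have "(\<Sum>k\<in>K. barrier k H Z) < 1" by simp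
  then have "(\<Sum>k\<in>K. rval (pd k H) Z) < rval H Z"
    using pos by (simp add: barrier_def flip: sum_divide_distrib)
  then show "rval (uaverage K H) Z > 0"
    unfolding rval_uaverage[OF HD(2) K] by simp
qed

section \<open>Averaging over all partitions\<close>

definition iaverage :: "(nat \<Rightarrow> 'i set) \<Rightarrow> nat list \<Rightarrow> (('i \<Rightarrow> complex) \<Rightarrow> complex) \<Rightarrow> ('i \<Rightarrow> complex) \<Rightarrow> complex" where
  "iaverage R is H = foldr (\<lambda>i. uaverage (R i)) is H"

lemma iaverage_simps [simp]:
  "iaverage R [] H = H"
  "iaverage R (i # is) H = uaverage (R i) (iaverage R is H)"
  by (simp_all add: iaverage_def)

lemma real_stable_iaverage:
  assumes "real_stable J H" "\<And>i. i \<in> set is \<Longrightarrow> R i \<subseteq> J \<and> card (R i) > 0"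
  shows "real_stable J (iaverage R is H)"
  using assms(2) by (induction "is") (auto intro!: real_stable_uaverage assms(1))

text \<open>Positivity is carried together with the statement that no barrier exceeds its initial
  value: this makes the bound assumed at \<open>Z0\<close> available for every later block.\<close>

lemma above_roots_iaverage:
  fixes dl :: real
  assumes H: "real_stable J H" and R: "\<And>i. i \<in> set is \<Longrightarrow> R i \<subseteq> J \<and> card (R i) > 0"
    and disj: "disjoint_family_on R (set is)" and "distinct is"
    and a: "above_roots J H Z0" and dl: "dl > 0"
    and bar: "\<And>i. i \<in> set is \<Longrightarrow> (\<Sum>k\<in>R i. barrier k H Z0) \<le> 1 - 1 / dl"
  shows "above_roots J (iaverage R is H) (\<lambda>j. if j \<in> \<Union>(R ` set is) then Z0 j + dl else Z0 j) \<and>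
    (\<forall>j\<in>J. barrier j (iaverage R is H) (\<lambda>j. if j \<in> \<Union>(R ` set is) then Z0 j + dl else Z0 j)
       \<le> barrier j H Z0)"
  using R disj \<open>distinct is\<close> bar
proof (induction "is")
  case Nil
  then show ?case using a by simp
next
  case (Cons i "is")
  let ?G = "iaverage R is H"
  let ?Z = "\<lambda>j. if j \<in> \<Union>(R ` set is) then Z0 j + dl else Z0 j"
  have disj: "disjoint_family_on R (set is)"
    using Cons.prems(2) by (auto simp: disjoint_family_on_def)
  have IH: "above_roots J ?G ?Z" "\<And>j. j \<in> J \<Longrightarrow> barrier j ?G ?Z \<le> barrier j H Z0"
    using Cons.IH[OF _ disj] Cons.prems by auto
  have Ri: "R i \<subseteq> J" "card (R i) > 0" using Cons.prems(1) by auto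
  have G: "real_stable J ?G" by (rule real_stable_iaverage[OF H]) (use Cons.prems(1) in auto)
  have "(\<Sum>k\<in>R i. barrier k ?G ?Z) \<le> (\<Sum>k\<in>R i. barrier k H Z0)"
    by (intro sum_mono IH) (use Ri in auto)
  also have "\<dots> \<le> 1 - 1 / dl" using Cons.prems(4) by simp
  finally have bar: "(\<Sum>k\<in>R i. barrier k ?G ?Z) \<le> 1 - 1 / dl" .
  also have "\<dots> < 1" using dl by simp
  finally have "above_roots J (uaverage (R i) ?G) ?Z"
    by (rule above_roots_uaverage[OF G Ri IH(1)])
  then have "above_roots J (uaverage (R i) ?G) (\<lambda>j. if j \<in> R i then ?Z j + dl else ?Z j)"
    by (rule above_roots_mono) (use dl in auto)
  moreover have "barrier j (uaverage (R i) ?G) (\<lambda>j. if j \<in> R i then ?Z j + dl else ?Z j) \<le> barrier j H Z0"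
    if "j \<in> J" for j
    using barrier_uaverage_shift[OF G Ri that IH(1) dl bar] IH(2)[OF that] by simp
  moreover have "(\<lambda>j. if j \<in> R i then ?Z j + dl else ?Z j) =
      (\<lambda>j. if j \<in> \<Union>(R ` set (i # is)) then Z0 j + dl else Z0 j)"
  proof -
    have "j \<notin> \<Union>(R ` set is)" if "j \<in> R i" for j
      using that Cons.prems(2,3) by (auto simp: disjoint_family_on_def)
    then show ?thesis by auto
  qed
  ultimately show ?case by simp
qed

text \<open>To the right of all roots each linear factor grows in absolute value.\<close>

lemma real_rooted_abs_mono:
  assumes "\<And>w. cpoly p w = 0 \<Longrightarrow> Im w = 0" and "\<And>x. x \<ge> b \<Longrightarrow> poly p x \<noteq> 0" and x: "x \<ge> b"
  shows "\<bar>poly p b\<bar> \<le> \<bar>poly p x\<bar>"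
  using assms(1,2)
proof (induction "degree p" arbitrary: p rule: less_induct)
  case less
  show ?case
  proof (cases "degree p = 0")
    case True
    then show ?thesis by (metis degree_eq_zeroE poly_const_conv order_refl)
  next
    case False
    have "degree (map_poly complex_of_real p) \<noteq> 0"
      using False by (simp add: degree_map_poly)
    then obtain z where z: "cpoly p z = 0"
      using alg_closed_imp_poly_has_root unfolding cpoly_def by blast
    then have "z = of_real (Re z)" using less.prems(1) by (simp add: complex_eq_iff)
    then have root: "poly p (Re z) = 0" using z by (metis cpoly_of_real of_real_eq_0_iff)
    then obtain q where q: "p = [:- Re z, 1:] * q" by (metis poly_eq_0_iff_dvd dvdE)
    have "p \<noteq> 0" using False by auto
    then have deg: "degree q < degree p" unfolding q by (subst degree_mult_eq) auto
    have "\<bar>poly q b\<bar> \<le> \<bar>poly q x\<bar>"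
      by (rule less.hyps[OF deg]) (use less.prems in \<open>auto simp: q\<close>)
    moreover have "Re z < b" using less.prems(2)[of "Re z"] root by force
    then have "\<bar>b - Re z\<bar> \<le> \<bar>x - Re z\<bar>" using x by simp
    moreover have "\<bar>poly p y\<bar> = \<bar>y - Re z\<bar> * \<bar>poly q y\<bar>" for y
      by (simp add: q abs_mult[symmetric] algebra_simps)
    ultimately show ?thesis by (simp add: mult_mono)
  qed
qed

lemma real_stable_diagonal:
  assumes G: "real_stable J G"
  obtains p where "\<And>w. G (\<lambda>_. w) = cpoly p w" "\<And>x. rval G (\<lambda>_. x) = poly p x"
proof -
  note GD = real_stableD[OF G]
  obtain p where p: "\<And>w. G (\<lambda>i. if i \<in> J then of_real 0 + w else of_real 0) = cpoly p w"
    "\<And>x. rval G (\<lambda>i. if i \<in> J then 0 + x else 0) = poly p x"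
    by (rule real_stable_line[OF GD(2,3,1) subset_refl, where Z = "\<lambda>_. 0"]) (rule that)
  show thesis
  proof (rule that[of p])
    show "G (\<lambda>_. w) = cpoly p w" for w
      unfolding p(1)[symmetric] by (rule multiaffine_cong[OF GD(2)]) simp
    show "rval G (\<lambda>_. x) = poly p x" for x
      unfolding p(2)[symmetric] by (rule rval_cong[OF GD(2)]) simp
  qed
qed

lemma real_stable_diagonal_mono:
  assumes G: "real_stable J G" and pos: "\<And>x. x \<ge> b \<Longrightarrow> rval G (\<lambda>_. x) > 0" and x: "x \<ge> b"
  shows "rval G (\<lambda>_. b) \<le> rval G (\<lambda>_. x)"
proof -
  obtain p where p: "\<And>w. G (\<lambda>_. w) = cpoly p w" "\<And>x. rval G (\<lambda>_. x) = poly p x"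
    by (rule real_stable_diagonal[OF G]) (rule that)
  have ppos: "poly p x > 0" if "x \<ge> b" for x
    unfolding p(2)[symmetric] using pos[OF that] .
  have nz: "\<not> Im w > 0" if w: "cpoly p w = 0" for w
  proof
    assume "Im w > 0"
    then have "G (\<lambda>_. w) \<noteq> 0" by (intro real_stableD(4)[OF G])
    then show False using w by (simp only: p)
  qed
  have "Im w = 0" if "cpoly p w = 0" for w
    using nz[OF that] nz[of "cnj w"] that by (simp add: cpoly_cnj)
  from real_rooted_abs_mono[OF this _ x] ppos have "\<bar>poly p b\<bar> \<le> \<bar>poly p x\<bar>"
    by (metis less_irrefl)
  then show ?thesis unfolding p(2) using ppos[OF x] ppos[of b] by simp
qed

text \<open>
  Moving the weights from the uniform ones to a vertex keeps the polynomial real-rooted and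
  positive at \<open>b\<close>. While it has no root beyond \<open>b\<close> it is bounded below by its value at \<open>b\<close>
  there, so no root can enter \<open>[b, \<infinity>)\<close> along the way.
\<close>

lemma shift_positive_if_uaverage_positive:
  assumes G: "real_stable J G" and K: "K \<subseteq> J" "card K > 0" and k: "k \<in> K"
    and avg: "\<And>x. x \<ge> b \<Longrightarrow> rval (uaverage K G) (\<lambda>_. x) > 0"
    and vertex: "rval (shift (card K) k G) (\<lambda>_. b) > 0"
    and big: "above_roots J G (\<lambda>_. X)" and x: "x \<ge> b"
  shows "rval (shift (card K) k G) (\<lambda>_. x) > 0"
proof -
  have finK: "finite K" using K(2) card_gt_0_iff by blast
  define c where "c t l = (1 - t) * (1 / real (card K)) + t * (if l = k then 1 else 0)" for t l
  define g where "g t x = rval (average (card K) K (c t) G) (\<lambda>_. x)" for t x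
  define g0 g1 where "g0 x = rval (uaverage K G) (\<lambda>_. x)" and "g1 x = rval (shift (card K) k G) (\<lambda>_. x)" for x
  have g: "g t x = (1 - t) * g0 x + t * g1 x" for t x
  proof -
    let ?F = "\<lambda>l. shift (real (card K)) l G (\<lambda>_. of_real x)"
    have "(\<Sum>l\<in>K. of_real (c t l) * ?F l) =
        (\<Sum>l\<in>K. of_real (1 - t) * (of_real (1 / real (card K)) * ?F l) + of_real t * (if l = k then ?F l else 0))"
      by (intro sum.cong) (auto simp: c_def algebra_simps)
    also have "\<dots> = of_real (1 - t) * (\<Sum>l\<in>K. of_real (1 / real (card K)) * ?F l) + of_real t * ?F k"
      using finK k by (simp only: sum.distrib sum_distrib_left[symmetric] sum.delta if_True)
    finally show ?thesis unfolding g_def g0_def g1_def rval_def uaverage_def average_def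
      by (simp only: plus_complex.sel times_complex.sel
        Re_complex_of_real Im_complex_of_real mult_zero_left diff_zero)
  qed
  have stable: "real_stable J (average (card K) K (c t) G)" if "t \<in> {0..1}" for t
  proof (rule real_stable_average[OF G K(1)])
    show "sum (c t) K = 1"
      using K(2) finK k by (auto simp: c_def sum.distrib simp flip: sum_distrib_left)
  qed (use that K(2) in \<open>auto simp: c_def\<close>)
  \<comment> \<open>Beyond \<open>Y\<close> every coordinate remains at least \<open>X\<close> after
    the shift, so \<open>g1\<close> is positive there.\<close>
  define Y where "Y = max b (X + real (card K))"
  have big: "g1 x > 0" if "x \<ge> Y" for x
  proof -
    have "g1 x = rval G ((\<lambda>_. x)(k := x - real (card K)))" unfolding g1_def rval_shift ..
    also have "\<dots> > 0" by (rule above_rootsD[OF big]) (use that in \<open>auto simp: Y_def\<close>)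
    finally show ?thesis .
  qed
  have poly: "\<exists>p. \<forall>x. rval F (\<lambda>_. x) = poly p x" if "real_stable J F" for F
    by (rule real_stable_diagonal[OF that]) blast
  have "continuous_on {b..Y} (\<lambda>x. g1 x - g0 x)"
  proof -
    obtain p where p: "\<And>x. g1 x = poly p x"
      using poly[OF real_stable_shift[OF G, of k "card K"]] k K(1) unfolding g1_def by blast
    obtain q where q: "\<And>x. g0 x = poly q x"
      using poly[OF real_stable_uaverage[OF G K]] unfolding g0_def by blast
    show ?thesis unfolding p q by (intro continuous_intros)
  qed
  then have "bounded ((\<lambda>x. g1 x - g0 x) ` {b..Y})"
    by (intro compact_imp_bounded compact_continuous_image compact_Icc)
  then obtain N where N: "\<forall>x\<in>{b..Y}. \<bar>g1 x - g0 x\<bar> \<le> N"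
    unfolding bounded_iff by auto
  \<comment> \<open>\<open>g t b\<close> is a convex combination of \<open>g0 b\<close> and
    \<open>g1 b\<close>, hence at least \<open>e\<close> for every \<open>t\<close>.\<close>
  define e where "e = min (g0 b) (g1 b)"
  have e: "e > 0" using avg[of b] vertex by (simp add: e_def g0_def g1_def)
  \<comment> \<open>The path is walked in \<open>M\<close> equal steps. On the compact interval up
    to \<open>Y\<close> one step changes \<open>g\<close> by less than \<open>e\<close>, which the
    lower bound absorbs; beyond \<open>Y\<close> both ends of the path are positive.\<close>
  obtain M :: nat where M: "N / e < real M" "M > 0"
    by (metis gr0I of_nat_0 reals_Archimedean2 less_trans max_less_iff_conj of_nat_0_less_iff)
  have "n \<le> M \<Longrightarrow> \<forall>x\<ge>b. g (n / M) x > 0" for n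
  proof (induction n)
    case 0
    then show ?case using avg by (simp add: g g0_def)
  next
    case (Suc n)
    define t where "t = real n / M"
    have t: "t \<in> {0..1}" using Suc.prems by (simp add: t_def)
    have IH: "\<And>x. x \<ge> b \<Longrightarrow> g t x > 0" using Suc by (simp add: t_def)
    have low: "e \<le> g t x" if "x \<ge> b" for x
    proof -
      have "e = (1 - t) * e + t * e" by (simp add: algebra_simps)
      also have "\<dots> \<le> g t b"
        unfolding g using t by (intro add_mono mult_left_mono) (auto simp: e_def)
      also have "\<dots> \<le> g t x"
        unfolding g_def by (rule real_stable_diagonal_mono[OF stable[OF t] _ that]) (use IH in \<open>simp add: g_def\<close>)
      finally show ?thesis .
    qed
    have t': "real (Suc n) / M = t + 1 / M" by (simp add: t_def add_divide_distrib add.commute)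
    have "g (t + 1 / M) x > 0" if x: "x \<ge> b" for x
    proof (cases "x \<le> Y")
      case True
      have "N < e * M" using M e by (simp add: field_simps)
      moreover have "\<bar>g1 x - g0 x\<bar> \<le> N" using N True x by simp
      ultimately have "\<bar>(g1 x - g0 x) / M\<bar> < e" using M(2) by (simp add: field_simps)
      moreover have "g (t + 1 / M) x = g t x + (g1 x - g0 x) / M"
        unfolding g by (simp add: algebra_simps diff_divide_distrib)
      ultimately show ?thesis using low[OF x] by linarith
    next
      case False
      have "g1 x > 0" by (rule big) (use False in simp)
      moreover have "g0 x > 0" using avg[OF x] by (simp add: g0_def)
      moreover have "t + 1 / M \<in> {0..1}" unfolding t'[symmetric] using Suc.prems M by simp
      ultimately show ?thesis unfolding g
        by (smt (verit) atLeastAtMost_iff mult_nonneg_nonneg mult_pos_pos)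
    qed
    then show ?case unfolding t' by blast
  qed
  from this[of M] have "g 1 x > 0" using M(2) x by simp
  then show ?thesis by (simp add: g g1_def)
qed

lemma above_roots_shift:
  assumes "above_roots J G (\<lambda>_. X)" "s \<ge> 0"
  shows "above_roots J (shift s k G) (\<lambda>_. X + s)"
  unfolding above_roots_def rval_shift
proof (intro allI impI)
  fix Z :: "'a \<Rightarrow> real" assume "\<forall>j\<in>J. X + s \<le> Z j"
  then show "rval G (Z(k := Z k - s)) > 0"
    by (intro above_rootsD[OF assms(1)]) (use assms(2) in \<open>force simp: algebra_simps\<close>)
qed

text \<open>A crude bound, wanted only to know that some \<open>X\<close> exists: it confines the
  path argument to a compact interval.\<close>

lemma above_roots_large_uaverage:
  assumes "above_roots J G (\<lambda>_. X)" "card K > 0"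
  shows "above_roots J (uaverage K G) (\<lambda>_. X + card K)"
  unfolding above_roots_def
proof (intro allI impI)
  fix Z :: "'a \<Rightarrow> real" assume Z: "\<forall>j\<in>J. X + card K \<le> Z j"
  have finK: "finite K" using assms(2) card_gt_0_iff by blast
  have "rval (shift (card K) k G) Z > 0" for k
    by (rule above_rootsD[OF above_roots_shift[OF assms(1)]]) (use Z in auto)
  then have "(\<Sum>k\<in>K. 1 / real (card K) * rval (shift (card K) k G) Z) > 0"
    using assms(2) finK by (intro sum_pos) auto
  then show "rval (uaverage K G) Z > 0"
    by (simp add: uaverage_def average_def rval_def)
qed

lemma shift_commute: "shift s k (shift s' l G) = shift s' l (shift s k G)"
  by (cases "k = l") (auto simp: shift_def fun_eq_iff fun_upd_twist algebra_simps)

lemma shift_iaverage: "shift s k (iaverage R is G) = iaverage R is (shift s k G)"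
proof (induction "is")
  case (Cons i "is")
  have "shift s k (uaverage (R i) F) = uaverage (R i) (shift s k F)" for F
  proof
    fix Z
    have "shift s k (uaverage (R i) F) Z =
        (\<Sum>l\<in>R i. of_real (1 / card (R i)) * shift s k (shift (card (R i)) l F) Z)"
      by (simp only: shift_def[of s k] uaverage_def average_def)
    also have "\<dots> = uaverage (R i) (shift s k F) Z"
      by (simp only: shift_commute[of s k] uaverage_def average_def)
    finally show "shift s k (uaverage (R i) F) Z = uaverage (R i) (shift s k F) Z" .
  qed
  with Cons show ?case by simp
qed simp

text \<open>Each step resolves the outermost average into one shift and moves that shift inside the
  remaining averages, with which it commutes. The shifted \<open>G\<close> is the input for the rest
  of the list, hence the generalisation over \<open>G\<close> and \<open>X\<close>.\<close>

lemma exists_vertex_positive: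
  assumes G: "real_stable J G" and R: "\<And>i. i \<in> set is \<Longrightarrow> R i \<subseteq> J \<and> card (R i) = r" and r: "r > 0"
    and disj: "disjoint_family_on R (set is)" and dist: "distinct is"
    and big: "above_roots J G (\<lambda>_. X)"
    and avg: "\<And>x. x \<ge> b \<Longrightarrow> rval (iaverage R is G) (\<lambda>_. x) > 0"
  shows "\<exists>a. (\<forall>i\<in>set is. a i \<in> R i) \<and>
    (\<forall>x\<ge>b. rval G (\<lambda>j. if j \<in> a ` set is then x - r else x) > 0)"
  using G R disj dist big avg
proof (induction "is" arbitrary: G X)
  case Nil
  then show ?case by simp
next
  case (Cons i "is")
  let ?Y = "iaverage R is G"
  have Ri: "R i \<subseteq> J" "card (R i) = r" "card (R i) > 0" using Cons.prems(2) r by auto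
  have finR: "finite (R i)" using Ri(3) card_gt_0_iff by blast
  have Y: "real_stable J ?Y"
    by (rule real_stable_iaverage[OF Cons.prems(1)]) (use Cons.prems(2) r in auto)
  have bigY: "\<exists>X. above_roots J (iaverage R js G) (\<lambda>_. X)" if "\<And>i. i \<in> set js \<Longrightarrow> card (R i) > 0" for js
    using that
  proof (induction js)
    case Nil
    then show ?case using Cons.prems(5) by auto
  next
    case (Cons j js)
    then obtain X where "above_roots J (iaverage R js G) (\<lambda>_. X)" by auto
    from above_roots_large_uaverage[OF this, of "R j"] Cons.prems show ?case by auto
  qed
  then obtain X' where X': "above_roots J ?Y (\<lambda>_. X')"
    using Cons.prems(2) r by (metis list.set_intros(2))
  have avgY: "\<And>x. x \<ge> b \<Longrightarrow> rval (uaverage (R i) ?Y) (\<lambda>_. x) > 0"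
    using Cons.prems(6) by simp
  \<comment> \<open>A positive average at \<open>b\<close> has a positive member.\<close>
  have "\<exists>k\<in>R i. rval (shift (card (R i)) k ?Y) (\<lambda>_. b) > 0"
  proof (rule ccontr)
    assume "\<not> ?thesis"
    then have "(\<Sum>k\<in>R i. 1 / card (R i) * rval (shift (card (R i)) k ?Y) (\<lambda>_. b)) \<le> 0"
      by (intro sum_nonpos mult_nonneg_nonpos) (auto simp: not_less)
    moreover have "(\<Sum>k\<in>R i. 1 / card (R i) * rval (shift (card (R i)) k ?Y) (\<lambda>_. b)) > 0"
      using avgY[of b] by (simp add: uaverage_def average_def rval_def)
    ultimately show False by simp
  qed
  then obtain k where k: "k \<in> R i" "rval (shift (card (R i)) k ?Y) (\<lambda>_. b) > 0" by blast
  have pos: "rval (iaverage R is (shift r k G)) (\<lambda>_. x) > 0" if "x \<ge> b" for x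
    using shift_positive_if_uaverage_positive[OF Y Ri(1,3) k(1) avgY k(2) X' that]
    by (simp only: shift_iaverage Ri)
  have "k \<in> J" using k Ri by blast
  have "disjoint_family_on R (set is)"
    using Cons.prems(3) by (auto simp: disjoint_family_on_def)
  from Cons.IH[OF real_stable_shift[OF Cons.prems(1) \<open>k \<in> J\<close>] _ this _ above_roots_shift[OF Cons.prems(5)] pos]
  obtain a where a: "\<forall>i\<in>set is. a i \<in> R i"
    "\<forall>x\<ge>b. rval (shift r k G) (\<lambda>j. if j \<in> a ` set is then x - r else x) > 0"
    using Cons.prems(2,4) by auto
  \<comment> \<open>Disjoint blocks ensure that coordinate \<open>k\<close> is lowered by
    \<open>r\<close> only once.\<close>
  have ki: "k \<notin> a ` set is"
  proof
    assume "k \<in> a ` set is"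
    then obtain l where l: "l \<in> set is" "k \<in> R l" using a(1) by blast
    then have "R i \<inter> R l = {}"
      using Cons.prems(3,4) unfolding disjoint_family_on_def by auto
    with l k(1) show False by blast
  qed
  have eq: "(a(i := k)) ` set (i # is) = insert k (a ` set is)"
    using Cons.prems(4) by auto
  have "rval G (\<lambda>j. if j \<in> insert k (a ` set is) then x - r else x) > 0" if "x \<ge> b" for x
  proof -
    have "(\<lambda>j. if j \<in> insert k (a ` set is) then x - r else x) =
        (\<lambda>j. if j \<in> a ` set is then x - r else x)(k := (if k \<in> a ` set is then x - r else x) - r)"
      using ki by auto
    then show ?thesis using a(2) that by (simp only: rval_shift)
  qed
  then show ?case
    by (intro exI[of _ "a(i := k)"]) (unfold eq, use a(1) k(1) Cons.prems(4) in auto)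
qed

section \<open>The determinantal polynomial of the vectors\<close>

text \<open>The Hermitian form \<open>v\<^sup>* x\<close>; \<open>inner\<close> on complex vectors
  is only its real part.\<close>

definition hip :: "complex ^ 'd \<Rightarrow> complex ^ 'd \<Rightarrow> complex" where
  "hip v x = (\<Sum>b\<in>UNIV. cnj (v $ b) * x $ b)"

definition wsum :: "('k \<Rightarrow> complex ^ 'd) \<Rightarrow> 'k set \<Rightarrow> ('k \<Rightarrow> complex) \<Rightarrow> complex ^ 'd ^ 'd" where
  "wsum u I z = (\<chi> a b. \<Sum>i\<in>I. z i * (u i $ a * cnj (u i $ b)))"

lemma wsum_mult_vec: "wsum u I z *v x = (\<Sum>i\<in>I. (z i * hip (u i) x) *s u i)"
proof -
  have "(\<Sum>b\<in>UNIV. (\<Sum>i\<in>I. z i * (u i $ a * cnj (u i $ b))) * x $ b) =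
      (\<Sum>i\<in>I. \<Sum>b\<in>UNIV. z i * (u i $ a * cnj (u i $ b)) * x $ b)" for a
    unfolding sum_distrib_right by (rule sum.swap)
  then show ?thesis
    by (simp add: vec_eq_iff matrix_vector_mult_def wsum_def hip_def sum_component sum_distrib_left
        sum_distrib_right mult_ac)
qed

lemma wsum_eq_sum_outer: "wsum u I (\<lambda>_. 1) = (\<Sum>i\<in>I. outer_self (u i))"
  by (simp add: vec_eq_iff wsum_def outer_self_def sum_component)

lemma hip_sum: "hip x (\<Sum>i\<in>I. c i *s u i) = (\<Sum>i\<in>I. c i * hip x (u i))"
proof -
  have "hip x (\<Sum>i\<in>I. c i *s u i) = (\<Sum>b\<in>UNIV. \<Sum>i\<in>I. c i * (cnj (x $ b) * u i $ b))"
    by (simp add: hip_def sum_component sum_distrib_left mult_ac)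
  also have "\<dots> = (\<Sum>i\<in>I. \<Sum>b\<in>UNIV. c i * (cnj (x $ b) * u i $ b))"
    by (rule sum.swap)
  finally show ?thesis by (simp add: hip_def sum_distrib_left)
qed

lemma cnj_hip: "cnj (hip v x) = hip x v"
  by (simp add: hip_def mult.commute)

lemma hip_self: "hip x x = of_real ((norm x)\<^sup>2)"
proof -
  have "(norm x)\<^sup>2 = (\<Sum>b\<in>UNIV. (cmod (x $ b))\<^sup>2)"
    by (simp add: norm_vec_def L2_set_def sum_nonneg)
  then show ?thesis
    unfolding hip_def by (simp only: of_real_sum complex_norm_square mult.commute)
qed

lemma inner_eq_Re_hip: "inner x y = Re (hip y x)"
  by (simp add: hip_def inner_vec_def inner_complex_def mult.commute)

section \<open>Determinants of weighted sums of rank-one matrices\<close>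

lemma det_eq_0_if_kernel:
  fixes A :: "complex ^ 'd ^ 'd"
  assumes "A *v x = 0" "x \<noteq> 0"
  shows "det A = 0"
  using assms invertible_det_nz invertible_left_inverse matrix_left_invertible_ker by metis

lemma kernel_if_det_eq_0:
  fixes A :: "complex ^ 'd ^ 'd"
  assumes "det A = 0"
  obtains x where "A *v x = 0" "x \<noteq> 0"
  using assms invertible_det_nz invertible_left_inverse matrix_left_invertible_ker by metis

lemma Re_mult_real: "Re (z * of_real x) = Re z * x"
  by simp

text \<open>
  The form \<open>x\<^sup>* (\<Sum>i\<in>I. z i \<cdot> u i u i\<^sup>*) x\<close> lies in the same open half-plane as the weights.
\<close>

lemma det_wsum_nonzero:
  assumes I: "finite I" "wsum u I (\<lambda>_. 1) = mat 1" and c: "\<And>i. i \<in> I \<Longrightarrow> Re (c * z i) > 0"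
  shows "det (wsum u I z) \<noteq> 0"
proof
  assume "det (wsum u I z) = 0"
  then obtain x where x: "wsum u I z *v x = 0" "x \<noteq> 0" by (rule kernel_if_det_eq_0)
  \<comment> \<open>The factor \<open>c\<close> rotates the half-plane to the right one:
    \<open>- \<i>\<close> serves stability, 1 serves positive weights.\<close>
  have "0 = c * hip x (wsum u I z *v x)" by (simp add: x hip_def)
  also have "\<dots> = (\<Sum>i\<in>I. c * z i * of_real ((cmod (hip (u i) x))\<^sup>2))"
    unfolding wsum_mult_vec hip_sum sum_distrib_left
    by (intro sum.cong refl) (simp add: complex_norm_square cnj_hip mult_ac del: of_real_power)
  finally have "0 = Re (\<Sum>i\<in>I. c * z i * of_real ((cmod (hip (u i) x))\<^sup>2))" by simp
  then have "(\<Sum>i\<in>I. Re (c * z i) * (cmod (hip (u i) x))\<^sup>2) = 0"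
    unfolding Re_sum Re_mult_real by simp
  then have "\<forall>i\<in>I. Re (c * z i) * (cmod (hip (u i) x))\<^sup>2 = 0"
    using c by (subst (asm) sum_nonneg_eq_0_iff[OF I(1)]) (auto intro!: mult_nonneg_nonneg simp: less_imp_le)
  then have 0: "hip (u i) x = 0" if "i \<in> I" for i using that c[OF that] by force
  have "x = mat 1 *v x" by simp
  also have "\<dots> = 0" unfolding I(2)[symmetric] wsum_mult_vec using 0 by (simp add: sum.neutral)
  finally show False using x(2) by blast
qed

lemma det_cnj: "det (\<chi> a b. cnj (A $ a $ b)) = cnj (det A)"
  by (simp add: det_def)

text \<open>Each rank-one summand is Hermitian, so conjugating the weights gives the conjugate
  transpose.\<close>

lemma det_wsum_cnj: "det (wsum u I (\<lambda>i. cnj (z i))) = cnj (det (wsum u I z))"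
proof -
  have "wsum u I (\<lambda>i. cnj (z i)) = (\<chi> a b. cnj (transpose (wsum u I z) $ a $ b))"
    by (simp add: vec_eq_iff wsum_def transpose_def mult_ac)
  then show ?thesis by (simp only: det_cnj det_transpose)
qed

lemma det_add_row_unit:
  fixes N :: "complex ^ 'd ^ 'd"
  shows "\<exists>b. \<forall>w. det (\<chi> i j. N $ i $ j + w * (if i = c \<and> j = c then 1 else 0)) = det N + w * b"
proof -
  let ?e = "\<lambda>_. (\<chi> j. if j = c then 1 else 0) :: complex ^ 'd"
  have "det (\<chi> i j. N $ i $ j + w * (if i = c \<and> j = c then 1 else 0)) =
     det N + w * det (\<chi> i. if i = c then ?e i else N $ i)" for w
  proof -
    have "(\<chi> i j. N $ i $ j + w * (if i = c \<and> j = c then 1 else 0)) =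
        (\<chi> i. if i = c then N $ i + w *s ?e i else N $ i)"
      by (auto simp: vec_eq_iff)
    moreover have "(\<chi> i. if i = c then N $ i else N $ i) = N" by (simp add: vec_eq_iff)
    ultimately show ?thesis
      by (simp only: det_row_add[of c "\<lambda>i. N $ i"] det_row_mul)
  qed
  then show ?thesis by blast
qed

text \<open>
  A change of basis sending the \<open>c\<close>-th unit vector to \<open>v\<close> turns the rank-one update into a change
  of a single entry.
\<close>

lemma det_rank_one_update_affine:
  fixes A :: "complex ^ 'd ^ 'd"
  shows "\<exists>b. \<forall>w. det (\<chi> i j. A $ i $ j + w * (v $ i * cnj (v $ j))) = det A + w * b"
proof (cases "v = 0")
  case True
  then show ?thesis by (intro exI[of _ 0]) simp
next
  case False
  then obtain c where c: "v $ c \<noteq> 0" by (auto simp: vec_eq_iff)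
  \<comment> \<open>The identity with column \<open>c\<close> replaced by \<open>v\<close>,
    invertible because \<open>v $ c\<close> is nonzero. With \<open>T\<close> its conjugate
    transpose, \<open>S ** E ** T\<close> is the rank-one matrix of \<open>v\<close>.\<close>
  define S :: "complex ^ 'd ^ 'd" where "S = (\<chi> i j. if j = c then v $ i else if i = j then 1 else 0)"
  define T :: "complex ^ 'd ^ 'd" where "T = (\<chi> i j. cnj (transpose S $ i $ j))"
  define E :: "complex ^ 'd ^ 'd" where "E = (\<chi> i j. if i = c \<and> j = c then 1 else 0)"
  have Sx: "(S *v x) $ i = v $ i * x $ c + (if i = c then 0 else x $ i)" for x i
  proof -
    have "(S *v x) $ i = (\<Sum>j\<in>UNIV. (if j = c then v $ i * x $ c else 0) + (if j = i then (if i = c then 0 else x $ i) else 0))"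
      unfolding matrix_vector_mult_def S_def vec_lambda_beta by (intro sum.cong refl) auto
    then show ?thesis by (simp add: sum.distrib)
  qed
  have "x = 0" if "S *v x = 0" for x
  proof -
    have 0: "v $ i * x $ c + (if i = c then 0 else x $ i) = 0" for i
      unfolding Sx[symmetric] that by simp
    from 0[of c] c have "x $ c = 0" by simp
    with 0 have "x $ i = 0" for i by (metis add_0 mult_zero_right)
    then show ?thesis by (simp add: vec_eq_iff)
  qed
  then have S: "det S \<noteq> 0" using kernel_if_det_eq_0 by blast
  then have T: "det T \<noteq> 0" unfolding T_def det_cnj by simp
  obtain S' where S': "S ** S' = mat 1" using S invertible_det_nz invertible_right_inverse by blast
  obtain T' where T': "T' ** T = mat 1" using T invertible_det_nz invertible_left_inverse by blast
  define N where "N = S' ** A ** T'"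
  have A: "A = S ** N ** T"
    unfolding N_def by (metis S' T' matrix_mul_assoc matrix_mul_lid matrix_mul_rid)
  have SET: "(S ** E ** T) $ i $ j = v $ i * cnj (v $ j)" for i j
  proof -
    have "(S ** E) $ i $ k = (if k = c then v $ i else 0)" for k
    proof -
      have "(S ** E) $ i $ k = (\<Sum>l\<in>UNIV. if l = c then (if k = c then v $ i else 0) else 0)"
        unfolding matrix_matrix_mult_def S_def E_def vec_lambda_beta by (intro sum.cong refl) auto
      then show ?thesis by simp
    qed
    then have "(S ** E ** T) $ i $ j = (\<Sum>k\<in>UNIV. if k = c then v $ i * T $ k $ j else 0)"
      unfolding matrix_matrix_mult_def[of "S ** E"] vec_lambda_beta by (intro sum.cong refl) auto
    then show ?thesis by (simp add: T_def S_def transpose_def)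
  qed
  obtain b where b: "\<And>w. det (\<chi> i j. N $ i $ j + w * (if i = c \<and> j = c then 1 else 0)) = det N + w * b"
    using det_add_row_unit[of N c] by blast
  have "det (\<chi> i j. A $ i $ j + w * (v $ i * cnj (v $ j))) = det A + w * (det S * b * det T)" for w
  proof -
    let ?N = "\<chi> i j. N $ i $ j + w * (if i = c \<and> j = c then 1 else 0)"
    have N: "?N = N + (\<chi> i. w *s E $ i)" by (simp add: vec_eq_iff E_def)
    have distr: "(F + G) ** T = F ** T + G ** T" for F G :: "complex ^ 'd ^ 'd"
      by (simp add: vec_eq_iff matrix_matrix_mult_def sum.distrib distrib_right)
    have w: "S ** (\<chi> i. w *s E $ i) ** T = (\<chi> i. w *s (S ** E ** T) $ i)"
      by (simp add: vec_eq_iff matrix_matrix_mult_def sum_distrib_left sum_distrib_right mult_ac)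
    have "(\<chi> i j. A $ i $ j + w * (v $ i * cnj (v $ j))) = S ** ?N ** T"
      unfolding N matrix_add_ldistrib distr w A[symmetric]
      by (simp add: vec_eq_iff SET)
    then show ?thesis by (simp add: det_mul b A algebra_simps)
  qed
  then show ?thesis by blast
qed

lemma det_wsum_affine:
  assumes "finite I" "i \<in> I"
  shows "det (wsum u I (z(i := w))) =
    det (wsum u I (z(i := 0))) + w * (det (wsum u I (z(i := 1))) - det (wsum u I (z(i := 0))))"
proof -
  have eq: "wsum u I (z(i := w)) = (\<chi> a b. wsum u I (z(i := 0)) $ a $ b + w * (u i $ a * cnj (u i $ b)))" for w
    using assms by (auto simp: vec_eq_iff wsum_def sum.remove[of I i] intro!: sum.cong)
  obtain b where b0: "\<forall>w. det (\<chi> a c. wsum u I (z(i := 0)) $ a $ c + w * (u i $ a * cnj (u i $ c))) =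
      det (wsum u I (z(i := 0))) + w * b"
    using det_rank_one_update_affine[of "wsum u I (z(i := 0))" "u i"] by blast
  have b: "det (wsum u I (z(i := w))) = det (wsum u I (z(i := 0))) + w * b" for w
    by (subst eq[of w]) (rule spec[OF b0])
  show ?thesis using b[of w] b[of 1] by simp
qed

text \<open>The sign is found by moving the weights linearly from all ones, where the determinant is
  1: along this path it is real and never zero.\<close>

lemma det_wsum_real_pos:
  assumes I: "finite I" "wsum u I (\<lambda>_. 1) = mat 1" and z: "\<And>i. i \<in> I \<Longrightarrow> z i > (0::real)"
  obtains x where "x > 0" "det (wsum u I (\<lambda>i. of_real (z i))) = of_real x"
proof -
  define f where "f \<theta> = det (wsum u I (\<lambda>i. of_real (1 + \<theta> * (z i - 1))))" for \<theta> :: real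
  have real: "f \<theta> = of_real (Re (f \<theta>))" for \<theta>
    using det_wsum_cnj[of u I "\<lambda>i. of_real (1 + \<theta> * (z i - 1))"]
    by (simp add: f_def complex_eq_iff)
  have nz: "Re (f \<theta>) \<noteq> 0" if "\<theta> \<in> {0..1}" for \<theta>
  proof -
    have "1 + \<theta> * (z i - 1) > 0" if "i \<in> I" for i
    proof -
      have "1 + \<theta> * (z i - 1) = (1 - \<theta>) + \<theta> * z i" by (simp add: algebra_simps)
      also have "\<dots> > 0"
        using \<open>\<theta> \<in> {0..1}\<close> z[OF that]
        by (cases "\<theta> = 0") (auto intro!: add_nonneg_pos mult_pos_pos)
      finally show ?thesis .
    qed
    then have "f \<theta> \<noteq> 0" unfolding f_def by (intro det_wsum_nonzero[OF I, where c = 1]) simp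
    then show ?thesis using real[of \<theta>] by auto
  qed
  have cont: "continuous_on {0..1} (\<lambda>\<theta>. Re (f \<theta>))"
    unfolding f_def det_def wsum_def by (simp, intro continuous_intros)
  have "f 0 = 1" by (simp add: f_def I(2))
  then have "Re (f 0) > 0" by simp
  have "Re (f 1) > 0"
  proof (rule ccontr)
    assume "\<not> Re (f 1) > 0"
    then have "\<exists>x\<ge>0. x \<le> 1 \<and> Re (f x) = 0"
      using \<open>Re (f 0) > 0\<close> by (intro IVT2' cont) auto
    then show False using nz by auto
  qed
  moreover have "det (wsum u I (\<lambda>i. of_real (z i))) = f 1" by (simp add: f_def)
  ultimately show thesis using that[of "Re (f 1)"] real[of 1] by (simp only:)
qed

section \<open>The product of determinants and its barriers\<close>

definition base_poly :: "(nat \<Rightarrow> complex ^ 'd) \<Rightarrow> nat \<Rightarrow> nat \<Rightarrow> (nat \<times> nat \<Rightarrow> complex) \<Rightarrow> complex" where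
  "base_poly u m r Z = (\<Prod>k\<in>{1..r}. det (wsum u {1..m} (\<lambda>i. Z (i, k))))"

lemma wsum_cong: "(\<And>i. i \<in> I \<Longrightarrow> z i = z' i) \<Longrightarrow> wsum u I z = wsum u I z'"
  by (simp add: wsum_def)

text \<open>Variable \<open>(i, k)\<close> enters only the \<open>k\<close>-th factor, as the
  coefficient of a rank-one term.\<close>

lemma multiaffine_base_poly: "multiaffine ({1..m} \<times> {1..r}) (base_poly u m r)"
  unfolding multiaffine_def
proof (intro conjI ballI allI impI)
  fix j :: "nat \<times> nat" and Z :: "nat \<times> nat \<Rightarrow> complex" and w
  assume "j \<in> {1..m} \<times> {1..r}"
  then obtain i k where j: "j = (i, k)" "i \<in> {1..m}" "k \<in> {1..r}" by auto
  define Q where "Q = (\<Prod>k'\<in>{1..r} - {k}. det (wsum u {1..m} (\<lambda>i. Z (i, k'))))"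
  define z where "z i = Z (i, k)" for i
  have eq: "base_poly u m r (Z(j := w)) = det (wsum u {1..m} (z(i := w))) * Q" for w
  proof -
    have "(\<lambda>i'. (Z(j := w)) (i', k)) = z(i := w)" by (auto simp: j z_def)
    moreover have "(\<Prod>k'\<in>{1..r} - {k}. det (wsum u {1..m} (\<lambda>i. (Z(j := w)) (i, k')))) = Q"
      unfolding Q_def by (intro prod.cong) (auto simp: j)
    ultimately show ?thesis
      unfolding base_poly_def using j(3) by (subst prod.remove[of _ k]) simp_all
  qed
  show "base_poly u m r (Z(j := w)) = base_poly u m r (Z(j := 0)) + w * pd j (base_poly u m r) Z"
    unfolding pd_def eq det_wsum_affine[OF finite_atLeastAtMost j(2), of u z w]
    by (simp add: algebra_simps)
next
  fix Z Z' :: "nat \<times> nat \<Rightarrow> complex" assume "\<forall>j\<in>{1..m} \<times> {1..r}. Z j = Z' j"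
  then show "base_poly u m r Z = base_poly u m r Z'"
    unfolding base_poly_def by (intro prod.cong refl arg_cong[where f = det] wsum_cong) auto
qed

lemma real_stable_base_poly:
  assumes "wsum u {1..m} (\<lambda>_. 1) = mat 1"
  shows "real_stable ({1..m} \<times> {1..r}) (base_poly u m r)"
  unfolding real_stable_def
proof (intro conjI allI impI multiaffine_base_poly)
  fix Z :: "nat \<times> nat \<Rightarrow> complex"
  show "base_poly u m r (\<lambda>j. cnj (Z j)) = cnj (base_poly u m r Z)"
    by (simp add: base_poly_def det_wsum_cnj)
  assume Z: "\<forall>j\<in>{1..m} \<times> {1..r}. 0 < Im (Z j)"
  have "det (wsum u {1..m} (\<lambda>i. Z (i, k))) \<noteq> 0" if "k \<in> {1..r}" for k
    by (rule det_wsum_nonzero[OF _ assms, where c = "- \<i>"]) (use Z that in auto)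
  then show "base_poly u m r Z \<noteq> 0" by (simp add: base_poly_def)
qed simp

lemma above_roots_base_poly:
  assumes "wsum u {1..m} (\<lambda>_. 1) = mat 1" and "t > 0"
  shows "above_roots ({1..m} \<times> {1..r}) (base_poly u m r) (\<lambda>_. t)"
  unfolding above_roots_def
proof (intro allI impI)
  fix Z :: "nat \<times> nat \<Rightarrow> real" assume Z: "\<forall>j\<in>{1..m} \<times> {1..r}. t \<le> Z j"
  have "\<exists>x>0. det (wsum u {1..m} (\<lambda>i. of_real (Z (i, k)))) = of_real x" if "k \<in> {1..r}" for k
    by (rule det_wsum_real_pos[OF _ assms(1), of "\<lambda>i. Z (i, k)"]) (use Z that assms(2) in force)+
  then obtain x where x: "\<And>k. k \<in> {1..r} \<Longrightarrow> x k > 0"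
    "\<And>k. k \<in> {1..r} \<Longrightarrow> det (wsum u {1..m} (\<lambda>i. of_real (Z (i, k)))) = of_real (x k)" by metis
  have "base_poly u m r (\<lambda>j. of_real (Z j)) = of_real (\<Prod>k\<in>{1..r}. x k)"
    unfolding base_poly_def of_real_prod by (intro prod.cong refl x)
  moreover have "(\<Prod>k\<in>{1..r}. x k) > 0" by (intro prod_pos x) auto
  ultimately show "rval (base_poly u m r) Z > 0" by (simp only: rval_def Re_complex_of_real)
qed

text \<open>An affine function with root \<open>y\<close> has logarithmic derivative
  \<open>1 / (t - y)\<close> at \<open>t\<close>. Here the root is the \<open>y\<close> for which
  \<open>t I + (y - t) u u\<^sup>*\<close> annihilates \<open>u = u i\<close>, which makes
  \<open>t - y\<close> equal to \<open>t / (norm u)\<^sup>2\<close>; a zero vector has no such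
  root.\<close>

lemma barrier_base_poly:
  assumes one: "wsum u {1..m} (\<lambda>_. 1) = mat 1" and t: "t > 0" and i: "i \<in> {1..m}" and k: "k \<in> {1..r}"
  shows "barrier (i, k) (base_poly u m r) (\<lambda>_. t) = (norm (u i))\<^sup>2 / t"
proof -
  let ?H = "base_poly u m r"
  have j: "(i, k) \<in> {1..m} \<times> {1..r}" using i k by simp
  have pos: "rval ?H (\<lambda>_. t) > 0" by (rule above_rootsD[OF above_roots_base_poly[OF one t]]) simp
  have mv: "wsum u {1..m} (\<lambda>i'. if i' = i then of_real y else of_real t) *v u i =
      of_real (t + (y - t) * (norm (u i))\<^sup>2) *s u i" for y :: real
  proof -
    have "wsum u {1..m} (\<lambda>i'. if i' = i then of_real y else of_real t) *v u i =
       (\<Sum>i'\<in>{1..m}. of_real t *s ((1 * hip (u i') (u i)) *s u i') +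
          (if i' = i then (of_real (y - t) * hip (u i) (u i)) *s u i else 0))"
      unfolding wsum_mult_vec by (intro sum.cong refl) (auto simp: vec_eq_iff algebra_simps)
    also have "\<dots> = of_real t *s (wsum u {1..m} (\<lambda>_. 1) *v u i) + (of_real (y - t) * hip (u i) (u i)) *s u i"
      unfolding wsum_mult_vec sum.distrib vec.scale_sum_right using i by simp
    finally show ?thesis unfolding one hip_self by (simp add: vec_eq_iff algebra_simps)
  qed
  have upd: "rval ?H ((\<lambda>_. t)((i, k) := y)) = rval ?H (\<lambda>_. t) + (y - t) * rval (pd (i, k) ?H) (\<lambda>_. t)" for y
    by (rule rval_upd[OF multiaffine_base_poly j])
  show ?thesis
  proof (cases "u i = 0")
    case True
    have "base_poly u m r (Z((i, k) := w)) = base_poly u m r Z" for Z w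
      unfolding base_poly_def wsum_def using True by (intro prod.cong arg_cong[where f = det]) (auto simp: vec_eq_iff intro!: sum.cong)
    then show ?thesis using True by (simp add: barrier_def pd_def rval_def)
  next
    case False
    define y where "y = t - t / (norm (u i))\<^sup>2"
    have "t + (y - t) * (norm (u i))\<^sup>2 = 0" using False by (simp add: y_def)
    then have "wsum u {1..m} (\<lambda>i'. if i' = i then of_real y else of_real t) *v u i = 0"
      unfolding mv by simp
    then have "det (wsum u {1..m} (\<lambda>i'. if i' = i then of_real y else of_real t)) = 0"
      using False by (rule det_eq_0_if_kernel)
    moreover have "(\<lambda>i'. complex_of_real (((\<lambda>_. t)((i, k) := y)) (i', k))) = (\<lambda>i'. if i' = i then of_real y else of_real t)"
      by auto
    ultimately have "base_poly u m r (\<lambda>j. of_real (((\<lambda>_. t)((i, k) := y)) j)) = 0"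
      unfolding base_poly_def using k by (intro prod_zero) (simp, metis)
    then have "rval ?H ((\<lambda>_. t)((i, k) := y)) = 0" by (simp add: rval_def)
    with upd[of y] have "t / (norm (u i))\<^sup>2 * rval (pd (i, k) ?H) (\<lambda>_. t) = rval ?H (\<lambda>_. t)"
      by (simp add: y_def)
    then show ?thesis unfolding barrier_def using False t pos by (simp add: field_simps)
  qed
qed

text \<open>The determinant is that of \<open>x I - s M\<close>, so no eigenvalue of
  \<open>M\<close> is \<open>b / s\<close> or more. The maximum \<open>\<mu>\<close> of the
  quadratic form on the unit sphere is shown to be an eigenvalue and to bound the operator
  norm.\<close>

lemma spectral_norm_sum_outer_le:
  fixes u :: "nat \<Rightarrow> complex ^ 'd"
  assumes one: "wsum u I (\<lambda>_. 1) = mat 1" and I: "finite I" "A \<subseteq> I" and s: "s > 0" and b: "b \<ge> 0"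
    and det: "\<And>x. x \<ge> b \<Longrightarrow> det (wsum u I (\<lambda>i. of_real (if i \<in> A then x - s else x))) \<noteq> 0"
  shows "spectral_norm (\<Sum>i\<in>A. outer_self (u i)) \<le> b / s"
proof -
  define M where "M = (\<Sum>i\<in>A. outer_self (u i))"
  have finA: "finite A" using I finite_subset by blast
  have Mv: "M *v v = (\<Sum>i\<in>A. hip (u i) v *s u i)" for v
    unfolding M_def wsum_eq_sum_outer[symmetric] wsum_mult_vec by simp
  define B where "B v w = (\<Sum>i\<in>A. inner (hip (u i) v) (hip (u i) w))" for v w
  have inner_M: "inner (M *v v) w = B v w" for v w
  proof -
    have "inner (M *v v) w = Re (\<Sum>i\<in>A. hip (u i) v * hip w (u i))"
      unfolding inner_eq_Re_hip Mv hip_sum ..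
    also have "\<dots> = B v w"
      unfolding B_def Re_sum by (intro sum.cong refl) (simp add: inner_complex_def cnj_hip[of "u _" w, symmetric])
    finally show ?thesis .
  qed
  have B_sym: "B v w = B w v" for v w by (simp add: B_def inner_commute)
  have lin: "inner (M *v (v - t *\<^sub>R w)) x = inner (M *v v) x - t * inner (M *v w) x" for v w x t
  proof -
    have "M *v (t *\<^sub>R w) = t *\<^sub>R (M *v w)"
      by (simp add: vec_eq_iff matrix_vector_mult_def scaleR_sum_right)
    then show ?thesis by (simp add: inner_diff_left matrix_vector_mult_diff_distrib)
  qed
  let ?S = "sphere 0 1 :: (complex ^ 'd) set"
  have "continuous_on ?S (\<lambda>v. B v v)"
    unfolding B_def hip_def by (intro continuous_intros)
  moreover have "?S \<noteq> {}" by simp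
  ultimately obtain v0 where v0: "v0 \<in> ?S" "\<And>v. v \<in> ?S \<Longrightarrow> B v v \<le> B v0 v0"
    using continuous_attains_sup[of ?S "\<lambda>v. B v v"] by auto
  define \<mu> where "\<mu> = B v0 v0"
  have v0n: "inner v0 v0 = 1" using v0(1) by (simp add: dot_square_norm)
  have \<mu>0: "\<mu> \<ge> 0" unfolding \<mu>_def B_def by (intro sum_nonneg) simp
  have B_le: "B v v \<le> \<mu> * (norm v)\<^sup>2" for v
  proof (cases "v = 0")
    case True
    then show ?thesis by (simp add: B_def hip_def)
  next
    case False
    define v1 where "v1 = (1 / norm v) *\<^sub>R v"
    have v: "v = norm v *\<^sub>R v1" using False by (simp add: v1_def)
    have "v1 \<in> ?S" using False by (simp add: v1_def)
    then have "B v1 v1 \<le> \<mu>" unfolding \<mu>_def by (rule v0(2))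
    moreover have "hip x (c *\<^sub>R y) = c *\<^sub>R hip x y" for x y :: "complex ^ 'd" and c
      by (simp add: hip_def scaleR_sum_right)
    then have "B v v = (norm v)\<^sup>2 * B v1 v1"
      by (subst v, subst (2) v) (simp add: B_def sum_distrib_left power2_eq_square mult_ac)
    ultimately show ?thesis by (simp add: mult.commute mult_right_mono)
  qed
  define n where "n = \<mu> *\<^sub>R v0 - M *v v0"
  define Q where "Q v = \<mu> * inner v v - B v v" for v
  \<comment> \<open>First variation at the maximiser: \<open>Q\<close> is nonnegative and vanishes
    at \<open>v0\<close>, and \<open>n\<close> is half its gradient there. Small \<open>t\<close>
    then forces \<open>n = 0\<close>, the eigenvalue equation.\<close>
  have "2 * inner n n \<le> t * Q n" if t: "t > 0" for t
  proof -
    have "0 \<le> Q (v0 - t *\<^sub>R n)" using B_le[of "v0 - t *\<^sub>R n"] by (simp add: Q_def power2_norm_eq_inner)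
    also have "Q (v0 - t *\<^sub>R n) = Q v0 - 2 * t * (\<mu> * inner v0 n - B v0 n) + t\<^sup>2 * Q n"
      unfolding Q_def inner_M[symmetric] lin
      using B_sym[of n v0] unfolding inner_M[symmetric]
      by (simp add: inner_diff_left inner_diff_right inner_commute power2_eq_square algebra_simps)
    also have "Q v0 = 0" by (simp add: Q_def v0n \<mu>_def)
    also have "\<mu> * inner v0 n - B v0 n = inner n n"
      unfolding inner_M[symmetric] by (simp add: n_def inner_diff_left)
    finally have "t * (2 * inner n n) \<le> t * (t * Q n)" by (simp add: power2_eq_square)
    then show ?thesis using t by simp
  qed
  note * = this
  have "n = 0"
  proof (rule ccontr)
    assume "n \<noteq> 0"
    then have nn: "inner n n > 0" by simp
    have "Q n > 0" using *[OF zero_less_one] nn by linarith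
    then show False using *[of "inner n n / Q n"] nn by simp
  qed
  then have eig: "M *v v0 = \<mu> *\<^sub>R v0" by (simp add: n_def)
  have "s * \<mu> < b"
  proof (rule ccontr)
    assume "\<not> s * \<mu> < b"
    then have "det (wsum u I (\<lambda>i. of_real (if i \<in> A then s * \<mu> - s else s * \<mu>))) \<noteq> 0" by (intro det) simp
    moreover have "wsum u I (\<lambda>i. of_real (if i \<in> A then s * \<mu> - s else s * \<mu>)) *v v0 = 0"
    proof -
      have "wsum u I (\<lambda>i. of_real (if i \<in> A then s * \<mu> - s else s * \<mu>)) *v v0 =
          (\<Sum>i\<in>I. of_real (s * \<mu>) *s ((1 * hip (u i) v0) *s u i) - (if i \<in> A then of_real s *s (hip (u i) v0 *s u i) else 0))"
        unfolding wsum_mult_vec by (intro sum.cong refl) (auto simp: vec_eq_iff algebra_simps)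
      also have "\<dots> = of_real (s * \<mu>) *s (wsum u I (\<lambda>_. 1) *v v0) - of_real s *s (M *v v0)"
        unfolding wsum_mult_vec Mv sum_subtractf vec.scale_sum_right
        using I by (simp add: sum.inter_restrict[symmetric] Int_absorb1)
      also have "\<dots> = 0" unfolding one eig
        by (simp add: vec_eq_iff scaleR_conv_of_real[where 'a = complex])
      finally show ?thesis .
    qed
    moreover have "v0 \<noteq> 0" using v0n by auto
    ultimately show False using det_eq_0_if_kernel by blast
  qed
  have "norm (M *v v) \<le> \<mu> * norm v" for v
  proof -
    \<comment> \<open>Since \<open>(norm (M *v v))\<^sup>2\<close> is \<open>B v (M *v v)\<close>,
      this bound for \<open>v\<close> and for \<open>M *v v\<close>, joined by Cauchy-Schwarz,
      leaves \<open>\<mu>\<close> times the two norms.\<close>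
    have L2: "L2_set (\<lambda>i. cmod (hip (u i) w)) A \<le> sqrt \<mu> * norm w" for w
    proof -
      have "L2_set (\<lambda>i. cmod (hip (u i) w)) A = sqrt (B w w)"
        by (simp add: L2_set_def B_def dot_square_norm)
      also have "\<dots> \<le> sqrt (\<mu> * (norm w)\<^sup>2)" using B_le by (rule real_sqrt_le_mono)
      finally show ?thesis by (simp add: real_sqrt_mult)
    qed
    have "(norm (M *v v))\<^sup>2 = B v (M *v v)" by (simp add: power2_norm_eq_inner inner_M)
    also have "\<dots> \<le> (\<Sum>i\<in>A. \<bar>cmod (hip (u i) v)\<bar> * \<bar>cmod (hip (u i) (M *v v))\<bar>)"
      unfolding B_def by (intro sum_mono) (simp add: norm_cauchy_schwarz)
    also have "\<dots> \<le> L2_set (\<lambda>i. cmod (hip (u i) v)) A * L2_set (\<lambda>i. cmod (hip (u i) (M *v v))) A"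
      by (rule L2_set_mult_ineq)
    also have "\<dots> \<le> (sqrt \<mu> * norm v) * (sqrt \<mu> * norm (M *v v))"
      by (intro mult_mono L2) (auto simp: \<mu>0)
    also have "\<dots> = \<mu> * norm v * norm (M *v v)" using \<mu>0 by (simp add: mult_ac)
    finally show ?thesis
      by (cases "norm (M *v v) = 0") (auto simp: power2_eq_square \<mu>0)
  qed
  then have "spectral_norm M \<le> \<mu>" unfolding spectral_norm_def by (intro onorm_le)
  also have "\<mu> \<le> b / s" using \<open>s * \<mu> < b\<close> s by (simp add: field_simps)
  finally show ?thesis unfolding M_def .
qed

theorem theorem1p8:
  fixes r m :: nat and \<delta> :: real and u :: "nat \<Rightarrow> complex ^ 'd"
  assumes "r > 1" and "\<delta> > 0"
    and "(\<Sum>i = 1..m. outer_self (u i)) = mat 1"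
    and "\<forall>i\<in>{1..m}. (norm (u i))\<^sup>2 \<le> \<delta>"
  shows "\<exists>A :: nat \<Rightarrow> nat set.
           disjoint_family_on A {1..r} \<and> (\<Union>j\<in>{1..r}. A j) = {1..m} \<and>
           (\<forall>j\<in>{1..r}. spectral_norm (\<Sum>i\<in>A j. outer_self (u i))
                        \<le> 1 / real r * (1 + sqrt (real r * \<delta>))\<^sup>2)"
proof -
  have one: "wsum u {1..m} (\<lambda>_. 1) = mat 1"
    unfolding wsum_eq_sum_outer by (rule assms(3))
  define e where "e = sqrt (real r * \<delta>)"
  have e: "e > 0" using assms(1,2) by (simp add: e_def)
  have e2: "e\<^sup>2 = real r * \<delta>" using assms(1,2) by (simp add: e_def)
  \<comment> \<open>The initial barrier sum is at most \<open>e\<^sup>2 / t = e / (1 + e)\<close>,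
    exactly the \<open>1 - 1 / dl\<close> allowed.\<close>
  define t where "t = e + e\<^sup>2"
  define dl where "dl = 1 + e"
  have t: "t > 0" and dl: "dl > 0" using e by (simp_all add: t_def dl_def add_pos_pos)
  have tdl: "t + dl = (1 + e)\<^sup>2" by (simp add: t_def dl_def power2_eq_square algebra_simps)
  let ?J = "{1..m} \<times> {1..r}"
  let ?H = "base_poly u m r"
  define R :: "nat \<Rightarrow> (nat \<times> nat) set" where "R i = {i} \<times> {1..r}" for i
  define ms where "ms = [1..<Suc m]"
  have set_ms: "set ms = {1..m}" and "distinct ms" by (auto simp: ms_def)
  have R: "R i \<subseteq> ?J" "card (R i) = r" if "i \<in> set ms" for i
    using that by (auto simp: R_def set_ms card_cartesian_product)
  have disj: "disjoint_family_on R (set ms)" by (auto simp: disjoint_family_on_def R_def)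
  have UR: "\<Union>(R ` set ms) = ?J" by (auto simp: R_def set_ms)
  have bar: "(\<Sum>k\<in>R i. barrier k ?H (\<lambda>_. t)) \<le> 1 - 1 / dl" if "i \<in> set ms" for i
  proof -
    have "(\<Sum>k\<in>R i. barrier k ?H (\<lambda>_. t)) = (\<Sum>k\<in>R i. (norm (u i))\<^sup>2 / t)"
      by (intro sum.cong refl) (use that in \<open>auto simp: R_def set_ms barrier_base_poly[OF one t]\<close>)
    also have "\<dots> = real r * (norm (u i))\<^sup>2 / t" using R(2)[OF that] by simp
    also have "\<dots> \<le> real r * \<delta> / t"
      using assms(4) that t by (intro divide_right_mono mult_left_mono) (auto simp: set_ms)
    also have "real r * \<delta> / t = e * e / (e * (1 + e))"
      unfolding e2[symmetric] t_def by (simp add: power2_eq_square algebra_simps)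
    also have "\<dots> = e / (1 + e)" using e by simp
    also have "\<dots> = 1 - 1 / dl"
      unfolding dl_def using e by (simp add: divide_simps)
    finally show ?thesis .
  qed
  note st = real_stable_base_poly[OF one, of r]
  note ab = above_roots_base_poly[OF one t, of r]
  have R': "R i \<subseteq> ?J \<and> card (R i) > 0" if "i \<in> set ms" for i using R[OF that] assms(1) by simp
  have "above_roots ?J (iaverage R ms ?H) (\<lambda>j. if j \<in> \<Union>(R ` set ms) then t + dl else t)"
    using above_roots_iaverage[OF st R' disj \<open>distinct ms\<close> ab dl bar] by blast
  then have avg: "rval (iaverage R ms ?H) (\<lambda>_. x) > 0" if "x \<ge> t + dl" for x
    by (rule above_rootsD) (use that in \<open>simp add: UR\<close>)
  obtain a where a: "\<forall>i\<in>set ms. a i \<in> R i"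
    "\<forall>x\<ge>t + dl. rval ?H (\<lambda>j. if j \<in> a ` set ms then x - r else x) > 0"
  proof -
    have "\<exists>a. (\<forall>i\<in>set ms. a i \<in> R i) \<and>
        (\<forall>x\<ge>t + dl. rval ?H (\<lambda>j. if j \<in> a ` set ms then x - r else x) > 0)"
      by (rule exists_vertex_positive[OF st _ _ disj \<open>distinct ms\<close> ab avg]) (use R assms(1) in auto)
    then show ?thesis using that by blast
  qed
  define A where "A k = {i\<in>{1..m}. a i = (i, k)}" for k
  have a_mem: "(i, k) \<in> a ` set ms \<longleftrightarrow> i \<in> A k" if "i \<in> {1..m}" for i k
    using a(1) that by (auto simp: A_def set_ms R_def image_iff) (metis atLeastAtMost_iff fst_conv)+
  have "spectral_norm (\<Sum>i\<in>A k. outer_self (u i)) \<le> (t + dl) / r" if k: "k \<in> {1..r}" for k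
  proof (rule spectral_norm_sum_outer_le[OF one])
    fix x assume x: "x \<ge> t + dl"
    let ?Z = "\<lambda>j. if j \<in> a ` set ms then x - r else x"
    \<comment> \<open>Positivity of the product makes each of its \<open>r\<close> determinants
      nonzero, so the same bound serves every part.\<close>
    have "base_poly u m r (\<lambda>j. of_real (?Z j)) \<noteq> 0"
      using a(2) x by (force simp: rval_def)
    then have "det (wsum u {1..m} (\<lambda>i. of_real (?Z (i, k)))) \<noteq> 0"
      using k by (simp add: base_poly_def)
    also have "wsum u {1..m} (\<lambda>i. of_real (?Z (i, k))) = wsum u {1..m} (\<lambda>i. of_real (if i \<in> A k then x - r else x))"
      by (rule wsum_cong) (simp add: a_mem)
    finally show "det (wsum u {1..m} (\<lambda>i. of_real (if i \<in> A k then x - r else x))) \<noteq> 0" .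
  qed (use t dl assms(1) in \<open>auto simp: A_def\<close>)
  moreover have "disjoint_family_on A {1..r}"
    by (auto simp: disjoint_family_on_def A_def)
  moreover have "(\<Union>j\<in>{1..r}. A j) = {1..m}"
    using a(1) by (fastforce simp: A_def R_def set_ms)
  ultimately show ?thesis
    unfolding tdl e_def by (intro exI[of _ A]) simp
qed

end
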